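(* Let $N=2$, $p=6$, let $\omega\subset\mathbb{R}$ be nonempty, open and bounded, and $\Omega:=\omega\times(0,1)$. Let $f:\mathbb{R}^2\to\mathbb{R}$, $f(\mu):=|\mu-\zeta_1|^2|\mu-\zeta_2|^2|\mu-\zeta_3|^2$ with $\zeta_1:=(0,-1)$, $\zeta_2:=(1,0)$, $\zeta_3:=(0,1)$, and let $u_0\in\mathcal{U}_0$ be given by $u_0(x_1,x_2):=(0,0)$ if $x_2\in(0,\frac12]$ and $u_0(x_1,x_2):=(1,0)$ if $x_2\in(\frac12,1)$. Then $$\tilde F_0(u_0)>0=\frac{|\omega\times(0,\frac12)|}{|\Omega|}\tilde F_0((0,0))+\frac{|\omega\times(\frac12,1)|}{|\Omega|}\tilde F_0((1,0)),$$ where $(0,0)$ and $(1,0)$ are regarded as constant functions on $\Omega$. In particular, there is no function $V:\mathbb{R}^2\to\mathbb{R}$ such that $\tilde F_0(u)=\int_\Omega V(u)\,dx$ for all $u\in\mathcal{U}_0$, and $\tilde F_0(u_0)>F^{**}(u_0)$.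
   Context: $\mathcal{U}_0:=\{u=(u^1,u^2)\in L^6(\Omega;\mathbb{R}^2):\partial_2u^2=0\text{ in }\Omega\}$ (distributional derivative). $\tilde F(u):=\int_\Omega f(u)\,dx$ if $u\in\mathcal{U}_0$ and $\tilde F(u):=+\infty$ if $u\in L^6(\Omega;\mathbb{R}^2)\setminus\mathcal{U}_0$. Its relaxation is $$\tilde F_0(u):=\inf\{\liminf_{n\to\infty}\tilde F(u_n): u_n\rightharpoonup u\text{ weakly in }L^6(\Omega;\mathbb{R}^2)\},\quad u\in L^6(\Omega;\mathbb{R}^2).$$ $F^{**}(u):=\int_\Omega f^{**}(u)\,dx$, where $f^{**}$ is the convex envelope of $f$. *)

theory Defs
  imports "HOL-Analysis.Analysis"
begin

text \<open>
  Functions on \<open>\<Omega>\<close> are represented by total functions; only their values on \<open>\<Omega>\<close> matter.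
  Elements of \<open>L\<^sup>p(\<Omega>)\<close> are representatives, not classes modulo equality almost everywhere.
\<close>

definition Lp :: "real \<Rightarrow> 'a::euclidean_space set \<Rightarrow> ('a \<Rightarrow> 'b::euclidean_space) set" where
  "Lp p \<Omega> = {u \<in> borel_measurable (lebesgue_on \<Omega>).
              integrable (lebesgue_on \<Omega>) (\<lambda>x. norm (u x) powr p)}"

definition Lp_norm :: "real \<Rightarrow> 'a::euclidean_space set \<Rightarrow> ('a \<Rightarrow> 'b::euclidean_space) \<Rightarrow> real" where
  "Lp_norm p \<Omega> u = (LINT x|lebesgue_on \<Omega>. norm (u x) powr p) powr (1 / p)"

text \<open>
  The continuous linear functionals on \<open>L\<^sup>p(\<Omega>)\<close>. Boundedness forces such a functional to take
  the same value on functions that agree almost everywhere in \<open>\<Omega>\<close>, so these are exactly the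
  continuous linear functionals on the quotient space.
\<close>

definition Lp_dual ::
    "real \<Rightarrow> 'a::euclidean_space set \<Rightarrow> (('a \<Rightarrow> 'b::euclidean_space) \<Rightarrow> real) set" where
  "Lp_dual p \<Omega> = {\<phi>.
     (\<forall>u\<in>Lp p \<Omega>. \<forall>v\<in>Lp p \<Omega>. \<phi> (\<lambda>x. u x + v x) = \<phi> u + \<phi> v) \<and>
     (\<forall>c. \<forall>u\<in>Lp p \<Omega>. \<phi> (\<lambda>x. c *\<^sub>R u x) = c * \<phi> u) \<and>
     (\<exists>C. \<forall>u\<in>Lp p \<Omega>. \<bar>\<phi> u\<bar> \<le> C * Lp_norm p \<Omega> u)}"

definition weakly_converges_Lp ::
    "real \<Rightarrow> 'a::euclidean_space set \<Rightarrow> (nat \<Rightarrow> 'a \<Rightarrow> 'b::euclidean_space) \<Rightarrow> ('a \<Rightarrow> 'b) \<Rightarrow> bool" where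
  "weakly_converges_Lp p \<Omega> u_seq u \<longleftrightarrow>
     (\<forall>n. u_seq n \<in> Lp p \<Omega>) \<and> u \<in> Lp p \<Omega> \<and>
     (\<forall>\<phi>\<in>Lp_dual p \<Omega>. (\<lambda>n. \<phi> (u_seq n)) \<longlonglongrightarrow> \<phi> u)"

primrec C_k :: "nat \<Rightarrow> ('a::euclidean_space \<Rightarrow> real) \<Rightarrow> bool" where
  "C_k 0 = (\<lambda>\<psi>. continuous_on UNIV \<psi>)"
| "C_k (Suc k) = (\<lambda>\<psi>. (\<forall>x. \<psi> differentiable (at x)) \<and>
     (\<forall>v. C_k k (\<lambda>x. frechet_derivative \<psi> (at x) v)))"

text \<open>\<open>C\<^sub>c\<^sup>\<infinity>(\<Omega>)\<close>, each function being extended by zero to the whole space.\<close>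

definition test_functions :: "'a::euclidean_space set \<Rightarrow> ('a \<Rightarrow> real) set" where
  "test_functions \<Omega> = {\<psi>. (\<forall>k. C_k k \<psi>) \<and>
     compact (closure {x. \<psi> x \<noteq> 0}) \<and> closure {x. \<psi> x \<noteq> 0} \<subseteq> \<Omega>}"

definition weak_d2_zero :: "(real \<times> real) set \<Rightarrow> (real \<times> real \<Rightarrow> real) \<Rightarrow> bool" where
  "weak_d2_zero \<Omega> w \<longleftrightarrow>
     (\<forall>\<psi>\<in>test_functions \<Omega>.
        (LINT x|lebesgue_on \<Omega>. w x * frechet_derivative \<psi> (at x) (0, 1)) = 0)"

definition U0 :: "(real \<times> real) set \<Rightarrow> (real \<times> real \<Rightarrow> real \<times> real) set" where
  "U0 \<Omega> = {u \<in> Lp 6 \<Omega>. weak_d2_zero \<Omega> (\<lambda>x. snd (u x))}"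

text \<open>
  Largest convex function below \<open>g\<close>. The supremum is taken in \<open>real\<close>, so it is meaningful for
  functions \<open>g\<close> that have a convex minorant, in particular for nonnegative ones.
\<close>

definition convex_envelope :: "('a::real_vector \<Rightarrow> real) \<Rightarrow> 'a \<Rightarrow> real" where
  "convex_envelope g x = Sup {h x | h. convex_on UNIV h \<and> (\<forall>y. h y \<le> g y)}"

definition \<zeta>\<^sub>1 :: "real \<times> real" where "\<zeta>\<^sub>1 = (0, -1)"
definition \<zeta>\<^sub>2 :: "real \<times> real" where "\<zeta>\<^sub>2 = (1, 0)"
definition \<zeta>\<^sub>3 :: "real \<times> real" where "\<zeta>\<^sub>3 = (0, 1)"

definition f :: "real \<times> real \<Rightarrow> real" where
  "f \<mu> = (norm (\<mu> - \<zeta>\<^sub>1))\<^sup>2 * (norm (\<mu> - \<zeta>\<^sub>2))\<^sup>2 * (norm (\<mu> - \<zeta>\<^sub>3))\<^sup>2"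

text \<open>
  Since \<open>0 \<le> f\<^sup>*\<^sup>*(\<mu>) \<le> f(\<mu>) \<le> C (1 + |\<mu>|\<^sup>6)\<close>, the integrands below are integrable whenever
  \<open>u\<close> is in \<open>L\<^sup>6(\<Omega>)\<close> and \<open>\<Omega>\<close> is bounded.
\<close>

definition F_tilde :: "(real \<times> real) set \<Rightarrow> (real \<times> real \<Rightarrow> real \<times> real) \<Rightarrow> ereal" where
  "F_tilde \<Omega> u = (if u \<in> U0 \<Omega> then ereal (LINT x|lebesgue_on \<Omega>. f (u x)) else \<infinity>)"

definition F_tilde_0 :: "(real \<times> real) set \<Rightarrow> (real \<times> real \<Rightarrow> real \<times> real) \<Rightarrow> ereal" where
  "F_tilde_0 \<Omega> u =
     Inf {liminf (\<lambda>n. F_tilde \<Omega> (u_seq n)) | u_seq. weakly_converges_Lp 6 \<Omega> u_seq u}"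

definition F_conv :: "(real \<times> real) set \<Rightarrow> (real \<times> real \<Rightarrow> real \<times> real) \<Rightarrow> ereal" where
  "F_conv \<Omega> u = ereal (LINT x|lebesgue_on \<Omega>. convex_envelope f (u x))"

definition u_0 :: "real \<times> real \<Rightarrow> real \<times> real" where
  "u_0 = (\<lambda>(x\<^sub>1, x\<^sub>2). if x\<^sub>2 \<le> 1/2 then (0, 0) else (1, 0))"

end

theory Submission
  imports Defs
begin

text \<open>
  If \<open>u\<close> is in \<open>U0\<close>, then its second component depends on \<open>x\<^sub>1\<close> only, so \<open>u(x)\<close> and \<open>u(x + (0,1/2))\<close> have
  the same second component. For \<open>f\<close> to be small at both points, their first components must be close
  too: \<open>f(s,t) + f(s',t) \<ge> (s' - s - 1/2) / 16\<close>. Integrating this over a box in the lower half of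
  \<open>\<Omega>\<close> bounds the energy from below by a functional that is continuous under weak convergence, and
  whose value at \<open>u_0\<close>, where \<open>s = 0\<close> and \<open>s' = 1\<close>, is positive.
  The constants have relaxed energy zero: \<open>(1,0)\<close> is a zero of \<open>f\<close>, and \<open>(0,0)\<close> is the weak
  limit of functions of \<open>x\<^sub>1\<close> that oscillate between the zeros \<open>(0,1)\<close> and \<open>(0,-1)\<close>.
\<close>

section \<open>Smooth functions and test functions\<close>

text \<open>\<open>f\<close> is not convex, so its integral cannot simply be passed to a weak limit.
  The pair estimate gets around this because its left side is affine in \<open>s\<close> and
  \<open>s'\<close> and free of \<open>t\<close>: after integration only one fixed continuous
  functional of the first component is left, and a weakly convergent sequence can be inserted there.
  Independence of \<open>x\<^sub>2\<close> is known only against test functions supported in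
  \<open>\<Omega>\<close>. It is therefore used as equality almost everywhere under a vertical
  shift, on boxes whose closed sweep stays inside \<open>\<Omega>\<close>. This is why smooth
  compactly supported functions have to be built by hand. The two bounds use weak convergence
  differently. The lower bound needs a single functional; zero energy of the constant
  \<open>(0, 0)\<close> needs convergence under every element of \<open>Lp_dual\<close>, which is an
  abstract set of functionals. The last two claims follow from positivity at \<open>u_0\<close>:
  \<open>u_0\<close> takes only the values \<open>(0, 0)\<close> and \<open>(1, 0)\<close>, where
  the constants force \<open>V\<close> to vanish and where the convex envelope vanishes as
  well.\<close>

lemma C_k_Suc_imp_C_k: "C_k (Suc k) g \<Longrightarrow> C_k k g"
proof (induction k arbitrary: g)
  case 0
  then show ?case
    by (auto simp: continuous_on_eq_continuous_at intro: differentiable_imp_continuous_within)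
next
  case (Suc k)
  then show ?case by (metis C_k.simps(2))
qed

text \<open>Lets an explicit derivative replace the choice term \<open>frechet_derivative\<close>;
  uniqueness of derivatives identifies the two.\<close>

lemma C_k_SucI:
  assumes "\<And>x. (g has_derivative g' x) (at x)" and "\<And>v. C_k k (\<lambda>x. g' x v)"
  shows "C_k (Suc k) g"
proof -
  have "frechet_derivative g (at x) = g' x" for x
    using frechet_derivative_at[OF assms(1)] by simp
  then show ?thesis
    using assms by (auto simp: differentiable_def)
qed

lemma C_k_Suc_has_derivative:
  "C_k (Suc k) g \<Longrightarrow> (g has_derivative frechet_derivative g (at x)) (at x)"
  using frechet_derivative_works by auto

lemma C_k_Suc_frechet: "C_k (Suc k) g \<Longrightarrow> C_k k (\<lambda>x. frechet_derivative g (at x) v)"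
  by simp

lemma C_k_const [simp]: "C_k k (\<lambda>_. c)"
proof (induction k arbitrary: c)
  case (Suc k)
  then show ?case
    by (intro C_k_SucI[where g' = "\<lambda>_ _. 0"]) auto
qed simp

lemma C_k_add: "C_k k g \<Longrightarrow> C_k k h \<Longrightarrow> C_k k (\<lambda>x. g x + h x)"
proof (induction k arbitrary: g h)
  case (Suc k)
  show ?case
    by (intro C_k_SucI[OF has_derivative_add[OF Suc.prems[THEN C_k_Suc_has_derivative]]] Suc.IH
        Suc.prems[THEN C_k_Suc_frechet])
qed (simp add: continuous_intros)

text \<open>The product rule brings back the undifferentiated factors, so smoothness of order
  \<open>Suc k\<close> must also be lowered to order \<open>k\<close> before the induction
  hypothesis applies.\<close>

lemma C_k_mult: "C_k k g \<Longrightarrow> C_k k h \<Longrightarrow> C_k k (\<lambda>x. g x * h x)"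
proof (induction k arbitrary: g h)
  case (Suc k)
  show ?case
    by (intro C_k_SucI[OF has_derivative_mult[OF Suc.prems[THEN C_k_Suc_has_derivative]]] Suc.IH
        C_k_add Suc.prems[THEN C_k_Suc_frechet] Suc.prems[THEN C_k_Suc_imp_C_k])
qed (simp add: continuous_intros)

lemma C_k_diff: "C_k k g \<Longrightarrow> C_k k h \<Longrightarrow> C_k k (\<lambda>x. g x - h x)"
  using C_k_add[of k g "\<lambda>x. (-1) * h x"] C_k_mult[of k "\<lambda>_. -1" h] by simp

lemma C_k_power: "C_k k g \<Longrightarrow> C_k k (\<lambda>x. g x ^ n)"
  by (induction n) (auto intro: C_k_mult)

lemma C_k_affine: "C_k k g \<Longrightarrow> bounded_linear L \<Longrightarrow> C_k k (\<lambda>x. g (c + L x))"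
proof (induction k arbitrary: g)
  case 0
  have "continuous_on UNIV (\<lambda>x. c + L x)"
    by (intro continuous_on_add continuous_on_const linear_continuous_on 0)
  then show ?case
    using 0 by (auto intro: continuous_on_compose2[of UNIV g])
next
  case (Suc k)
  have "((\<lambda>x. g (c + L x)) has_derivative (\<lambda>v. frechet_derivative g (at (c + L x)) (L v))) (at x)" for x
  proof -
    have "((\<lambda>x. c + L x) has_derivative L) (at x)"
      using bounded_linear_imp_has_derivative[OF Suc.prems(2)]
      by (auto intro!: derivative_eq_intros)
    from diff_chain_at[OF this C_k_Suc_has_derivative[OF Suc.prems(1)]]
    show ?thesis by (simp add: o_def)
  qed
  then show ?case
    by (rule C_k_SucI) (intro Suc.IH C_k_Suc_frechet Suc.prems)
qed

lemma C_k_Suc_real: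
  assumes "\<And>x. (g has_real_derivative g' x) (at x)" and "C_k k g'"
  shows "C_k (Suc k) g"
  by (rule C_k_SucI[where g' = "\<lambda>x v. g' x * v"])
     (use assms in \<open>auto simp: has_field_derivative_def intro: C_k_mult\<close>)

text \<open>The classical smooth function exp(-1/x) is \<open>flat 0\<close>. The factor
  \<open>(1 / x) ^ n\<close> makes the family closed under differentiation up to linear
  combinations, so one induction on the order gives smoothness of all members.\<close>

definition flat :: "nat \<Rightarrow> real \<Rightarrow> real" where
  "flat n x = (if x > 0 then (1 / x) ^ n * exp (- (1 / x)) else 0)"

text \<open>From the right, y = 1/x turns the claim into y^n / exp y tending to 0 at
  infinity.\<close>

lemma tendsto_flat_0: "(flat n \<longlongrightarrow> 0) (at 0)"
proof (rule filterlim_split_at)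
  show "(flat n \<longlongrightarrow> 0) (at_left 0)"
    by (rule tendsto_eventually) (auto simp: flat_def eventually_at_filter)
  have "((\<lambda>x::real. (inverse x) ^ n / exp (inverse x)) \<longlongrightarrow> 0) (at_right 0)"
    by (rule filterlim_compose[OF tendsto_power_div_exp_0 filterlim_inverse_at_top_right])
  then show "(flat n \<longlongrightarrow> 0) (at_right 0)"
    by (rule Lim_transform_eventually)
       (auto simp: flat_def eventually_at_filter exp_minus divide_inverse)
qed

lemma flat_has_derivative:
  "(flat n has_real_derivative flat (n + 2) x - real n * flat (n + 1) x) (at x)"
proof -
  consider "x < 0" | "x = 0" | "x > 0" by linarith
  then show ?thesis
  proof cases
    case 1
    have "((\<lambda>_. 0) has_real_derivative flat (n + 2) x - real n * flat (n + 1) x) (at x)"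
      using 1 by (simp add: flat_def)
    then show ?thesis
      by (rule has_field_derivative_transform_within[where d = "- x"]) (use 1 in \<open>auto simp: flat_def dist_real_def\<close>)
  next
    case 2
    \<comment> \<open>Dividing by \<open>y\<close> only raises the index: the difference quotient at
      0 is \<open>flat (n + 1)\<close>, whose limit is known.\<close>
    have "((\<lambda>y. (flat n y - flat n 0) / (y - 0)) \<longlongrightarrow> 0) (at 0)"
      by (rule Lim_transform_eventually[OF tendsto_flat_0[of "n + 1"]])
         (auto simp: flat_def eventually_at_filter)
    then show ?thesis
      using 2 by (simp add: has_field_derivative_iff flat_def)
  next
    case 3
    have "((\<lambda>x. (1 / x) ^ n * exp (- (1 / x))) has_real_derivative
            flat (n + 2) x - real n * flat (n + 1) x) (at x)"
    proof -
      \<comment> \<open>The power rule produces the truncated exponent \<open>n - 1\<close>; the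
        split makes the exponents comparable.\<close>
      consider "n = 0" | "n = 1" | m where "n = Suc (Suc m)"
        by (metis One_nat_def not0_implies_Suc)
      then show ?thesis
      proof cases
        case (3 m)
        have "m = 0 \<or> x ^ m = x * x ^ (m - Suc 0)"
          by (cases m) auto
        with 3 \<open>x > 0\<close> show ?thesis
          by (auto intro!: derivative_eq_intros simp: flat_def field_simps power2_eq_square)
      qed (use 3 in \<open>auto intro!: derivative_eq_intros simp: flat_def field_simps power2_eq_square\<close>)
    qed
    then show ?thesis
      by (rule has_field_derivative_transform_within[where d = x]) (use 3 in \<open>auto simp: flat_def dist_real_def\<close>)
  qed
qed

lemma C_k_flat: "C_k k (flat n)"
proof (induction k arbitrary: n)
  case 0
  show ?case
    using flat_has_derivative[THEN DERIV_isCont] by (simp add: continuous_on_eq_continuous_at)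
next
  case (Suc k)
  show ?case
    by (rule C_k_Suc_real[OF flat_has_derivative]) (intro C_k_diff C_k_mult C_k_const Suc.IH)
qed

text \<open>With y the product of the two flat functions, y lies in (0, 1] inside the interval and
  is 0 outside, so 1 - (1 - y)^n tends to the indicator. This gives smooth approximations of an
  indicator without constructing plateaus.\<close>

definition bump :: "real \<Rightarrow> real \<Rightarrow> nat \<Rightarrow> real \<Rightarrow> real" where
  "bump a b n x = 1 - (1 - flat 0 (x - a) * flat 0 (b - x)) ^ n"

lemma C_k_bump: "C_k k (bump a b n)"
proof -
  have "C_k k (\<lambda>x. flat 0 (- a + x))" "C_k k (\<lambda>x. flat 0 (b + (- x)))"
    by (intro C_k_affine C_k_flat bounded_linear_ident bounded_linear_minus)+
  then show ?thesis
    unfolding bump_def[abs_def] by (intro C_k_diff C_k_const C_k_power C_k_mult) simp_all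
qed

lemma flat_0_bounds: "0 \<le> flat 0 x" "flat 0 x \<le> 1" "x > 0 \<Longrightarrow> flat 0 x > 0"
  by (auto simp: flat_def)

lemma bump_outside: "x \<notin> {a<..<b} \<Longrightarrow> bump a b n x = 0"
  by (auto simp: bump_def flat_def)

lemma bump_bounds: "\<bar>bump a b n x\<bar> \<le> 1"
proof -
  have "0 \<le> 1 - flat 0 (x - a) * flat 0 (b - x)" "1 - flat 0 (x - a) * flat 0 (b - x) \<le> 1"
    using flat_0_bounds by (auto intro: mult_le_one)
  then have "0 \<le> (1 - flat 0 (x - a) * flat 0 (b - x)) ^ n"
    "(1 - flat 0 (x - a) * flat 0 (b - x)) ^ n \<le> 1"
    by (auto intro: power_le_one)
  then show ?thesis by (simp add: bump_def)
qed

lemma bump_tendsto: "(\<lambda>n. bump a b n x) \<longlonglongrightarrow> indicator {a<..<b} x"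
proof (cases "x \<in> {a<..<b}")
  case True
  define y where "y = flat 0 (x - a) * flat 0 (b - x)"
  have "0 < y" "y \<le> 1"
    using True flat_0_bounds unfolding y_def by (auto intro: mult_le_one)
  then have "(\<lambda>n. (1 - y) ^ n) \<longlonglongrightarrow> 0"
    by (intro LIMSEQ_power_zero) auto
  from tendsto_diff[OF tendsto_const[of 1] this] show ?thesis
    using True by (simp add: bump_def y_def)
qed (simp add: bump_outside)

lemma continuous_bump: "continuous_on A (bump a b n)"
  using C_k_bump[of 0 a b n] by (auto intro: continuous_on_subset)

lemma ex_antiderivative:
  fixes \<beta> :: "real \<Rightarrow> real"
  assumes "continuous_on UNIV \<beta>"
  obtains \<Theta> where "\<And>x. (\<Theta> has_real_derivative \<beta> x) (at x)"
proof -
  define \<Theta> where "\<Theta> x = interval_lebesgue_integral lborel 0 (ereal x) \<beta>" for x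
  have "(\<Theta> has_real_derivative \<beta> x) (at x)" for x
  proof -
    \<comment> \<open>The compact interval contains the base point 0 and has \<open>x\<close> in its
      interior, so the derivative within it is the full derivative.\<close>
    have "(\<Theta> has_vector_derivative \<beta> x) (at x within {-\<bar>x\<bar>-1..\<bar>x\<bar>+1})"
      unfolding \<Theta>_def zero_ereal_def
      by (rule interval_integral_FTC2) (auto intro: continuous_on_subset[OF assms])
    moreover have "at x within {-\<bar>x\<bar>-1..\<bar>x\<bar>+1} = at x"
      by (rule at_within_interior) (auto simp: interior_cbox)
    ultimately show ?thesis by (simp add: has_real_derivative_iff_has_vector_derivative)
  qed
  then show thesis using that by blast
qed

text \<open>Separated variables let the derivative in direction \<open>(0, 1)\<close> fall on
  \<open>B\<close> alone: the derivative of \<open>\<alpha>\<close> is evaluated at increment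
  0.\<close>

lemma tensor_test_function:
  fixes \<alpha> B B' :: "real \<Rightarrow> real"
  assumes \<alpha>: "\<And>k. C_k k \<alpha>" and B: "\<And>k. C_k k B" and B': "\<And>x. (B has_real_derivative B' x) (at x)"
    and \<alpha>0: "\<And>x. x \<notin> {a..b} \<Longrightarrow> \<alpha> x = 0" and B0: "\<And>x. x \<notin> {c..d} \<Longrightarrow> B x = 0"
    and sub: "{a..b} \<times> {c..d} \<subseteq> \<Omega>"
  defines "\<psi> \<equiv> \<lambda>x. \<alpha> (fst x) * B (snd x)"
  shows "\<psi> \<in> test_functions \<Omega>"
    and "frechet_derivative \<psi> (at x) (0, 1) = \<alpha> (fst x) * B' (snd x)"
proof -
  have "C_k k \<psi>" for k
    using C_k_affine[OF \<alpha> bounded_linear_fst, of k 0] C_k_affine[OF B bounded_linear_snd, of k 0]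
    unfolding \<psi>_def by (auto intro: C_k_mult)
  moreover have supp: "closure {x. \<psi> x \<noteq> 0} \<subseteq> {a..b} \<times> {c..d}"
  proof (rule closure_minimal)
    show "{x. \<psi> x \<noteq> 0} \<subseteq> {a..b} \<times> {c..d}"
      unfolding \<psi>_def using \<alpha>0 B0 by (auto, (metis atLeastAtMost_iff)+)
  qed (intro closed_Times closed_atLeastAtMost)
  moreover have "compact (closure {x. \<psi> x \<noteq> 0})"
    using bounded_subset[OF bounded_Times[OF bounded_closed_interval bounded_closed_interval] supp]
    by (simp add: compact_eq_bounded_closed)
  ultimately show "\<psi> \<in> test_functions \<Omega>"
    using sub unfolding test_functions_def by blast
  have "(\<alpha> has_derivative frechet_derivative \<alpha> (at (fst x))) (at (fst x))"
    by (rule C_k_Suc_has_derivative[OF \<alpha>])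
  from has_derivative_compose[OF has_derivative_fst[OF has_derivative_ident] this]
  have 1: "((\<lambda>x. \<alpha> (fst x)) has_derivative (\<lambda>v. frechet_derivative \<alpha> (at (fst x)) (fst v))) (at x)" .
  have "(B has_derivative (\<lambda>v. B' (snd x) * v)) (at (snd x))"
    using B' by (simp add: has_field_derivative_def)
  from has_derivative_compose[OF has_derivative_snd[OF has_derivative_ident] this]
  have 2: "((\<lambda>x. B (snd x)) has_derivative (\<lambda>v. B' (snd x) * snd v)) (at x)" .
  have "frechet_derivative \<alpha> (at (fst x)) 0 = 0"
    using \<alpha>[of "Suc 0"] by (auto intro!: linear_0 linear_frechet_derivative)
  then show "frechet_derivative \<psi> (at x) (0, 1) = \<alpha> (fst x) * B' (snd x)"
    using frechet_derivative_at[OF has_derivative_mult[OF 1 2], symmetric] unfolding \<psi>_def by simp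
qed

section \<open>Functions with vanishing weak derivative\<close>

text \<open>Open boxes form an intersection-stable generator of the Borel sets, so a Dynkin argument
  extends the vanishing integrals to all of them. \<open>total\<close> serves the complement step,
  since the whole space is not a box.\<close>

lemma AE_eq_0_if_box_integrals_eq_0:
  fixes D :: "'a::euclidean_space \<Rightarrow> real"
  assumes D: "integrable lborel D" and total: "(LBINT x. D x) = 0"
    and box: "\<And>a b. (LBINT x:box a b. D x) = 0"
  shows "AE x in lborel. D x = 0"
proof (rule density_unique_real[OF D, of "\<lambda>_. 0", simplified])
  have set_int: "set_integrable lborel A D" if "A \<in> sets borel" for A
    unfolding set_integrable_def using that D by (intro integrable_mult_indicator) auto
  fix A :: "'a set" assume "A \<in> sets borel"
  then have A: "A \<in> sigma_sets UNIV (range (\<lambda>(a, b). box a b))"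
    unfolding borel_eq_box by simp
  have "Int_stable (range (\<lambda>(a, b). box a b :: 'a set))"
    by (auto simp: Int_stable_def box_Int_box)
  moreover have "range (\<lambda>(a, b). box a b :: 'a set) \<subseteq> Pow UNIV"
    by simp
  ultimately show "(LBINT x:A. D x) = 0"
    using A
  proof (induction rule: sigma_sets_induct_disjoint)
    case (basic A)
    then show ?case using box by auto
  next
    case empty
    then show ?case by (simp add: set_lebesgue_integral_def)
  next
    case (compl A)
    then have A: "A \<in> sets borel" unfolding borel_eq_box by simp
    have "(LBINT x:A \<union> (UNIV - A). D x) = (LBINT x:A. D x) + (LBINT x:UNIV - A. D x)"
      using A by (intro set_integral_Un set_int) auto
    then show ?case
      using compl total by (simp add: set_lebesgue_integral_def)
  next
    case (union A)
    then have A: "range A \<subseteq> sets borel" unfolding borel_eq_box by simp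
    have "(LBINT x:(\<Union>i. A i). D x) = (\<Sum>i. LBINT x:A i. D x)"
      using A union(1) by (intro lebesgue_integral_countable_add set_int) (auto simp: disjoint_family_on_def)
    then show ?case using union by simp
  qed
qed

lemma lborel_integral_translate:
  fixes g :: "'a::euclidean_space \<Rightarrow> 'b::{banach, second_countable_topology}"
  assumes "g \<in> borel_measurable borel"
  shows "(LBINT x. g (c + x)) = (LBINT x. g x)"
  using integral_distr[of "(+) c" lborel borel g] assms by (simp add: lborel_distr_plus)

lemma lborel_integrable_translate:
  fixes g :: "'a::euclidean_space \<Rightarrow> 'b::{banach, second_countable_topology}"
  assumes "integrable lborel g"
  shows "integrable lborel (\<lambda>x. g (c + x))"
  using integrable_distr[of "(+) c" lborel borel g] assms by (simp add: lborel_distr_plus)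

lemma box_real_prod: "box (a, c) (b, d) = {a<..<b::real} \<times> {c<..<d::real}"
  by (auto simp: box_def Basis_prod_def)

text \<open>
  Testing with \<open>\<psi>(x) = \<alpha>(x\<^sub>1) (\<Theta>(x\<^sub>2) - \<Theta>(x\<^sub>2 - h))\<close>, where \<open>\<Theta>' = \<beta>\<close>, and letting the smooth functions
  \<open>\<alpha>\<close> and \<open>\<beta>\<close> tend to indicators.
\<close>

lemma weak_d2_zero_box_integral_shift:
  fixes W :: "real \<times> real \<Rightarrow> real"
  assumes W: "integrable lborel W"
    and weak: "\<And>\<psi>. \<psi> \<in> test_functions \<Omega> \<Longrightarrow>
      (LBINT x. W x * frechet_derivative \<psi> (at x) (0, 1)) = 0"
    and sub: "{a..b} \<times> {c..d + h} \<subseteq> \<Omega>" and h: "h \<ge> 0"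
  shows "(LBINT x:box (a, c) (b, d). W x) = (LBINT x:box (a, c) (b, d). W ((0, h) + x))"
proof -
  define I where "I x = (indicator {a<..<b} (fst x) :: real)
      * (indicator {c<..<d} (snd x) - indicator {c<..<d} (snd x - h))" for x :: "real \<times> real"
  define J where "J n x = bump a b n (fst x) * (bump c d n (snd x) - bump c d n (snd x - h))"
    for n and x :: "real \<times> real"
  have J0: "(LBINT x. W x * J n x) = 0" for n
  proof -
    obtain \<Theta> where \<Theta>: "\<And>x. (\<Theta> has_real_derivative bump c d n x) (at x)"
      using ex_antiderivative[OF continuous_bump] by blast
    define B where "B x = \<Theta> x - \<Theta> (x - h)" for x
    have B': "(B has_real_derivative bump c d n x - bump c d n (x - h)) (at x)" for x
      unfolding B_def[abs_def]
      by (auto intro!: derivative_eq_intros DERIV_chain2[OF \<Theta>] \<Theta>)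
    have "C_k k (\<lambda>x. bump c d n (- h + x))" for k
      by (intro C_k_affine C_k_bump bounded_linear_ident)
    then have "C_k (Suc k) B" for k
      by (intro C_k_Suc_real[OF B'] C_k_diff C_k_bump) simp
    then have B: "C_k k B" for k
      by (rule C_k_Suc_imp_C_k)
    have const: "\<Theta> x = \<Theta> y" if "convex S" "x \<in> S" "y \<in> S" "S \<inter> {c<..<d} = {}" for x y S
    proof -
      have "(\<Theta> has_real_derivative 0) (at z within S)" if "z \<in> S" for z
      proof -
        have "z \<notin> {c<..<d}"
          using that \<open>S \<inter> {c<..<d} = {}\<close> by blast
        from bump_outside[OF this] show ?thesis
          using \<Theta>[of z] by (auto intro: has_field_derivative_at_within)
      qed
      from has_field_derivative_zero_constant[OF \<open>convex S\<close> this] show ?thesis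
        using that by metis
    qed
    \<comment> \<open>\<open>\<Theta>\<close> itself need not vanish to the right of
      \<open>d\<close>. Left of \<open>c\<close> and right of \<open>d + h\<close>, however,
      \<open>x\<close> and \<open>x - h\<close> lie on the same side of the interval, where
      \<open>\<Theta>\<close> is constant, so the difference has compact support.\<close>
    have B0: "B x = 0" if "x \<notin> {c..d + h}" for x
    proof -
      have "{..c} \<inter> {c<..<d} = {}" "{d..} \<inter> {c<..<d} = {}" by auto
      with that const[of "{..c}" x "x - h"] const[of "{d..}" x "x - h"] h show ?thesis
        by (auto simp: B_def not_le)
    qed
    have \<alpha>0: "bump a b n x = 0" if "x \<notin> {a..b}" for x
      using that by (intro bump_outside) auto
    note tensor = tensor_test_function[OF C_k_bump B B' \<alpha>0 B0 sub]
    have "frechet_derivative (\<lambda>x. bump a b n (fst x) * B (snd x)) (at x) (0, 1) = J n x" for x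
      unfolding J_def by (rule tensor(2))
    then show ?thesis
      using weak[OF tensor(1)] by simp
  qed
  have [measurable]: "W \<in> borel_measurable borel" using W by auto
  have [measurable]: "bump a b n \<in> borel_measurable borel" for a b n
    using continuous_bump by (rule borel_measurable_continuous_onI)
  have [measurable]: "I \<in> borel_measurable borel" "J n \<in> borel_measurable borel" for n
    unfolding I_def[abs_def] J_def[abs_def] borel_prod[symmetric] by measurable
  have "(\<lambda>n. LBINT x. W x * J n x) \<longlonglongrightarrow> (LBINT x. W x * I x)"
  proof (rule integral_dominated_convergence[where w = "\<lambda>x. 2 * \<bar>W x\<bar>"])
    show "AE x in lborel. (\<lambda>n. W x * J n x) \<longlonglongrightarrow> W x * I x"
      unfolding I_def J_def by (intro AE_I2 tendsto_intros bump_tendsto)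
    show "AE x in lborel. norm (W x * J n x) \<le> 2 * \<bar>W x\<bar>" for n
    proof (rule AE_I2)
      fix x
      have "\<bar>J n x\<bar> \<le> 1 * 2"
        unfolding J_def abs_mult using bump_bounds[of c d n "snd x"] bump_bounds[of c d n "snd x - h"]
        by (intro mult_mono bump_bounds) auto
      from mult_left_mono[OF this, of "\<bar>W x\<bar>"] show "norm (W x * J n x) \<le> 2 * \<bar>W x\<bar>"
        by (simp add: abs_mult)
    qed
  qed (use W in auto)
  then have I0: "(LBINT x. W x * I x) = 0"
    by (simp add: J0 LIMSEQ_const_iff)
  let ?Q = "box (a, c) (b, d)"
  \<comment> \<open>The shift is put inside the indicator so that a translation by
    \<open>(0, h)\<close> can later move it onto \<open>W\<close>.\<close>
  have I_eq: "W x * I x = W x * indicator ?Q x - W x * indicator ?Q ((0, - h) + x)" for x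
    by (cases x) (auto simp: I_def box_real_prod indicator_def)
  have "integrable lborel (\<lambda>x. W x * indicator ((\<lambda>x. (0, - h) + x) -` ?Q) x)"
    by (intro integrable_real_mult_indicator W)
       (auto intro!: borel_open open_vimage continuous_intros)
  then have 1: "integrable lborel (\<lambda>x. W x * indicator ?Q ((0, - h) + x))"
    by (simp add: indicator_def)
  have "(LBINT x. W x * indicator ?Q x) = (LBINT x. W x * indicator ?Q ((0, - h) + x))"
    using I0 unfolding I_eq
    by (subst (asm) Bochner_Integration.integral_diff)
       (auto intro!: integrable_real_mult_indicator W 1)
  also have "\<dots> = (LBINT x. W ((0, h) + x) * indicator ?Q x)"
  proof -
    have "(\<lambda>x. W x * indicator ?Q ((0, - h) + x)) \<in> borel_measurable borel"
      by measurable
    from lborel_integral_translate[OF this, of "(0, h)"] show ?thesis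
      by (simp add: add.assoc[symmetric] zero_prod_def[symmetric])
  qed
  finally show ?thesis
    by (simp add: set_lebesgue_integral_def mult.commute)
qed

text \<open>The intersection of any box with the given one is again a box satisfying the support
  condition. Hence the identity of integrals holds on all of them, and the localized difference
  \<open>D\<close> has zero integral over every box.\<close>

lemma weak_d2_zero_AE_shift:
  fixes W :: "real \<times> real \<Rightarrow> real"
  assumes W: "integrable lborel W"
    and weak: "\<And>\<psi>. \<psi> \<in> test_functions \<Omega> \<Longrightarrow>
      (LBINT x. W x * frechet_derivative \<psi> (at x) (0, 1)) = 0"
    and sub: "{a..b} \<times> {c..d + h} \<subseteq> \<Omega>" and h: "h \<ge> 0"
  shows "AE x in lborel. x \<in> box (a, c) (b, d) \<longrightarrow> W ((0, h) + x) = W x"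
proof -
  let ?Q = "box (a, c) (b, d)"
  define D where "D x = indicator ?Q x *\<^sub>R (W ((0, h) + x) - W x)" for x
  have W': "integrable lborel (\<lambda>x. W ((0, h) + x))"
    by (rule lborel_integrable_translate[OF W])
  have D: "integrable lborel D"
    unfolding D_def[abs_def] using W W' by (intro integrable_mult_indicator) auto
  have box0: "(LBINT x:box p q. D x) = 0" for p q
  proof (cases p, cases q)
    fix p1 p2 q1 q2 assume pq: "p = (p1, p2)" "q = (q1, q2)"
    define P where "P = box (max a p1, max c p2) (min b q1, min d q2)"
    have P: "P = box p q \<inter> ?Q"
      unfolding P_def pq box_real_prod by auto
    have int: "set_integrable lborel P W" "set_integrable lborel P (\<lambda>x. W ((0, h) + x))"
      using W W' unfolding set_integrable_def P_def by (intro integrable_mult_indicator; simp)+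
    have "{max a p1..min b q1} \<times> {max c p2..min d q2 + h} \<subseteq> \<Omega>"
      using sub by (rule subset_trans[rotated]) auto
    from weak_d2_zero_box_integral_shift[OF W weak this h]
    have "(LBINT x:P. W ((0, h) + x) - W x) = 0"
      using int by (simp add: set_integral_diff P_def)
    also have "(LBINT x:P. W ((0, h) + x) - W x) = (LBINT x:box p q. D x)"
      unfolding set_lebesgue_integral_def
      by (rule Bochner_Integration.integral_cong) (auto simp: D_def P indicator_def)
    finally show ?thesis .
  qed
  have "(LBINT x. D x) = (LBINT x:?Q. D x)"
    unfolding set_lebesgue_integral_def
    by (rule Bochner_Integration.integral_cong) (auto simp: D_def indicator_def)
  also have "\<dots> = 0" by (rule box0)
  finally have "AE x in lborel. D x = 0"
    by (rule AE_eq_0_if_box_integrals_eq_0[OF D _ box0])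
  then show ?thesis
    by (rule AE_mp) (auto simp: D_def)
qed

section \<open>Lebesgue spaces and growth of the integrand\<close>

text \<open>Translation and measure-theoretic steps below are carried out for Borel functions on
  \<open>lborel\<close>, whereas elements of \<open>Lp\<close> are only Lebesgue measurable on
  \<open>S\<close>.\<close>

lemma ex_borel_representative_real:
  fixes u :: "'a::euclidean_space \<Rightarrow> real"
  assumes u: "u \<in> borel_measurable (lebesgue_on S)" and S: "S \<in> sets borel"
  obtains U where "U \<in> borel_measurable borel" "AE x in lborel. x \<in> S \<longrightarrow> u x = U x"
proof -
  have "(\<lambda>x. indicator S x *\<^sub>R u x) \<in> borel_measurable lebesgue"
    using u S by (subst (asm) borel_measurable_restrict_space_iff) auto
  from completion_ex_borel_measurable_real[OF this]
  obtain U where "U \<in> borel_measurable lborel" "AE x in lborel. indicator S x *\<^sub>R u x = U x"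
    by auto
  note U = this
  have "AE x in lborel. x \<in> S \<longrightarrow> u x = U x"
    using U(2) by eventually_elim auto
  with U(1) show thesis
    by (intro that[of U]) auto
qed

lemma ex_borel_representative:
  fixes u :: "'a::euclidean_space \<Rightarrow> real \<times> real"
  assumes u: "u \<in> borel_measurable (lebesgue_on S)" and S: "S \<in> sets borel"
  obtains U where "U \<in> borel_measurable borel" "AE x in lborel. x \<in> S \<longrightarrow> u x = U x"
proof -
  have "(\<lambda>x. fst (u x)) \<in> borel_measurable (lebesgue_on S)"
    "(\<lambda>x. snd (u x)) \<in> borel_measurable (lebesgue_on S)"
    using u unfolding borel_prod[symmetric] by measurable
  note comp = this
  obtain U1 where U1: "U1 \<in> borel_measurable borel" "AE x in lborel. x \<in> S \<longrightarrow> fst (u x) = U1 x"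
    using ex_borel_representative_real[OF comp(1) S] .
  obtain U2 where U2: "U2 \<in> borel_measurable borel" "AE x in lborel. x \<in> S \<longrightarrow> snd (u x) = U2 x"
    using ex_borel_representative_real[OF comp(2) S] .
  have "AE x in lborel. x \<in> S \<longrightarrow> u x = (U1 x, U2 x)"
    using U1(2) U2(2) by eventually_elim (auto simp: prod_eq_iff)
  moreover have "(\<lambda>x. (U1 x, U2 x)) \<in> borel_measurable borel"
    using U1(1) U2(1) by (rule borel_measurable_Pair)
  ultimately show thesis
    by (rule that[rotated])
qed

lemma lebesgue_on_eq_lborel:
  fixes k h :: "'a::euclidean_space \<Rightarrow> real"
  assumes S: "S \<in> sets borel" and k: "k \<in> borel_measurable (lebesgue_on S)"
    and h: "h \<in> borel_measurable borel" and eq: "AE x in lborel. x \<in> S \<longrightarrow> k x = h x"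
  shows "(LINT x|lebesgue_on S. k x) = (LBINT x:S. h x)"
    and "integrable (lebesgue_on S) k \<longleftrightarrow> set_integrable lborel S h"
proof -
  have [measurable]: "(\<lambda>x. indicator S x *\<^sub>R k x) \<in> borel_measurable lebesgue"
    using k S by (subst (asm) borel_measurable_restrict_space_iff) auto
  have h': "(\<lambda>x. indicator S x *\<^sub>R h x) \<in> borel_measurable lborel"
    using h S by auto
  note [measurable] = measurable_completion[OF this]
  have eq': "AE x in lebesgue. indicator S x *\<^sub>R k x = indicator S x *\<^sub>R h x"
  proof (rule AE_completion)
    show "AE x in lborel. indicator S x *\<^sub>R k x = indicator S x *\<^sub>R h x"
      using eq by eventually_elim (auto simp: indicator_def)
  qed
  have "(LINT x|lebesgue_on S. k x) = (LINT x|lebesgue. indicator S x *\<^sub>R k x)"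
    using S by (intro integral_restrict_space) auto
  also have "\<dots> = (LINT x|lebesgue. indicator S x *\<^sub>R h x)"
    by (intro integral_cong_AE eq') measurable
  finally show "(LINT x|lebesgue_on S. k x) = (LBINT x:S. h x)"
    using h' by (simp add: integral_completion set_lebesgue_integral_def)
  have "integrable (lebesgue_on S) k \<longleftrightarrow> integrable lebesgue (\<lambda>x. indicator S x *\<^sub>R k x)"
    using S by (intro integrable_restrict_space) auto
  also have "\<dots> \<longleftrightarrow> integrable lebesgue (\<lambda>x. indicator S x *\<^sub>R h x)"
    by (intro integrable_cong_AE eq') measurable
  finally show "integrable (lebesgue_on S) k \<longleftrightarrow> set_integrable lborel S h"
    using h' by (simp add: integrable_completion set_integrable_def)
qed

lemma finite_measure_lebesgue_on_bounded:
  assumes "S \<in> sets borel" "bounded S"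
  shows "finite_measure (lebesgue_on S)"
  using assms emeasure_bounded_finite[of S]
  by (intro finite_measureI) (simp add: emeasure_restrict_space)

lemma le_1_plus_powr: "(0::real) \<le> r \<Longrightarrow> 1 \<le> p \<Longrightarrow> r \<le> 1 + r powr p"
  using powr_mono[of 1 p r] by (cases "r \<le> 1") (auto intro: add_increasing2)

lemma Lp_integrable_norm:
  assumes fin: "finite_measure (lebesgue_on \<Omega>)" and p: "1 \<le> p" and u: "u \<in> Lp p \<Omega>"
  shows "integrable (lebesgue_on \<Omega>) (\<lambda>x. norm (u x))"
proof -
  interpret finite_measure "lebesgue_on \<Omega>" by fact
  show ?thesis
    by (rule Bochner_Integration.integrable_bound[where f = "\<lambda>x. 1 + norm (u x) powr p"])
       (use u p in \<open>auto simp: Lp_def intro!: le_1_plus_powr\<close>)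
qed

lemma Lp_norm_nonneg: "0 \<le> Lp_norm p \<Omega> u"
  by (simp add: Lp_norm_def)

lemma Lp_norm_powr: "p \<noteq> 0 \<Longrightarrow> Lp_norm p \<Omega> u powr p = (LINT x|lebesgue_on \<Omega>. norm (u x) powr p)"
  by (simp add: Lp_norm_def powr_powr)

text \<open>A Hoelder estimate with a cruder constant: integrate r <= 1 + r^p with r = |u| / N,
  where N is the norm. If N = 0, then \<open>u\<close> vanishes almost everywhere.\<close>

lemma integral_norm_le_Lp_norm:
  assumes fin: "finite_measure (lebesgue_on \<Omega>)" and p: "1 \<le> p" and u: "u \<in> Lp p \<Omega>"
  shows "(LINT x|lebesgue_on \<Omega>. norm (u x))
    \<le> (measure (lebesgue_on \<Omega>) (space (lebesgue_on \<Omega>)) + 1) * Lp_norm p \<Omega> u"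
proof -
  interpret finite_measure "lebesgue_on \<Omega>" by fact
  have int: "integrable (lebesgue_on \<Omega>) (\<lambda>x. norm (u x) powr p)"
    and [measurable]: "u \<in> borel_measurable (lebesgue_on \<Omega>)"
    using u by (auto simp: Lp_def)
  note int1 = Lp_integrable_norm[OF assms]
  let ?N = "Lp_norm p \<Omega> u"
  show ?thesis
  proof (cases "?N = 0")
    case True
    then have "(LINT x|lebesgue_on \<Omega>. norm (u x) powr p) = 0"
      by (simp add: Lp_norm_def)
    then have "AE x in lebesgue_on \<Omega>. norm (u x) powr p = 0"
      using integral_nonneg_eq_0_iff_AE[OF int] by simp
    then have "AE x in lebesgue_on \<Omega>. norm (u x) = 0"
      by (rule AE_mp) simp
    then have "(LINT x|lebesgue_on \<Omega>. norm (u x)) = (LINT x|lebesgue_on \<Omega>. 0)"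
      by (intro integral_cong_AE) auto
    with True show ?thesis by simp
  next
    case False
    then have N: "?N > 0"
      using Lp_norm_nonneg[of p \<Omega> u] by linarith
    have "(LINT x|lebesgue_on \<Omega>. norm (u x))
        \<le> (LINT x|lebesgue_on \<Omega>. ?N * (1 + (norm (u x) powr p) / ?N powr p))"
    proof (rule integral_mono[OF int1])
      show "integrable (lebesgue_on \<Omega>) (\<lambda>x. ?N * (1 + (norm (u x) powr p) / ?N powr p))"
        using int by auto
      show "norm (u x) \<le> ?N * (1 + (norm (u x) powr p) / ?N powr p)" for x
        using le_1_plus_powr[of "norm (u x) / ?N" p] N p
        by (simp add: powr_divide divide_le_eq mult.commute)
    qed
    also have "\<dots> = ?N * (measure (lebesgue_on \<Omega>) (space (lebesgue_on \<Omega>)) + 1)"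
      using int N p Lp_norm_powr[of p \<Omega> u, symmetric] by simp
    finally show ?thesis by (simp add: mult.commute)
  qed
qed

lemma Lp_dual_weighted_integral:
  fixes g :: "'a::euclidean_space \<Rightarrow> real" and L :: "'b::euclidean_space \<Rightarrow> real"
  assumes fin: "finite_measure (lebesgue_on \<Omega>)" and p: "1 \<le> p"
    and g [measurable]: "g \<in> borel_measurable (lebesgue_on \<Omega>)" and g1: "\<And>x. \<bar>g x\<bar> \<le> 1"
    and L: "linear L" and L1: "\<And>y. \<bar>L y\<bar> \<le> norm y"
  shows "(\<lambda>u. LINT x|lebesgue_on \<Omega>. g x * L (u x)) \<in> Lp_dual p \<Omega>"
proof -
  interpret L: linear L by (rule L)
  have int: "integrable (lebesgue_on \<Omega>) (\<lambda>x. g x * L (u x))"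
    and le: "\<bar>LINT x|lebesgue_on \<Omega>. g x * L (u x)\<bar> \<le> (LINT x|lebesgue_on \<Omega>. norm (u x))"
    if u: "u \<in> Lp p \<Omega>" for u :: "'a \<Rightarrow> 'b"
  proof -
    have bd: "\<bar>g x * L (u x)\<bar> \<le> norm (u x)" for x
      using mult_mono[OF g1[of x] L1[of "u x"]] by (simp add: abs_mult)
    have [measurable]: "u \<in> borel_measurable (lebesgue_on \<Omega>)"
      using u by (simp add: Lp_def)
    have "continuous_on UNIV L"
      using L by (intro linear_continuous_on) (simp add: linear_conv_bounded_linear)
    then have [measurable]: "L \<in> borel_measurable borel"
      by (rule borel_measurable_continuous_onI)
    show int: "integrable (lebesgue_on \<Omega>) (\<lambda>x. g x * L (u x))"
      by (rule Bochner_Integration.integrable_bound[OF Lp_integrable_norm[OF fin p u]])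
         (use bd in auto)
    show "\<bar>LINT x|lebesgue_on \<Omega>. g x * L (u x)\<bar> \<le> (LINT x|lebesgue_on \<Omega>. norm (u x))"
      by (rule order_trans[OF integral_abs_bound])
         (intro integral_mono Lp_integrable_norm[OF fin p u] integrable_abs int bd)
  qed
  show ?thesis
    unfolding Lp_dual_def
  proof (intro CollectI conjI ballI allI exI)
    fix u v :: "'a \<Rightarrow> 'b" assume "u \<in> Lp p \<Omega>" "v \<in> Lp p \<Omega>"
    then show "(LINT x|lebesgue_on \<Omega>. g x * L (u x + v x))
        = (LINT x|lebesgue_on \<Omega>. g x * L (u x)) + (LINT x|lebesgue_on \<Omega>. g x * L (v x))"
      using int by (simp add: L.add distrib_left)
  next
    fix u :: "'a \<Rightarrow> 'b" and c
    show "(LINT x|lebesgue_on \<Omega>. g x * L (c *\<^sub>R u x)) = c * (LINT x|lebesgue_on \<Omega>. g x * L (u x))"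
      by (simp add: L.scale mult.left_commute)
  next
    fix u :: "'a \<Rightarrow> 'b" assume u: "u \<in> Lp p \<Omega>"
    show "\<bar>LINT x|lebesgue_on \<Omega>. g x * L (u x)\<bar>
        \<le> (measure (lebesgue_on \<Omega>) (space (lebesgue_on \<Omega>)) + 1) * Lp_norm p \<Omega> u"
      using le[OF u] integral_norm_le_Lp_norm[OF fin p u] by linarith
  qed
qed

section \<open>Pointwise bounds for the integrand\<close>

lemma f_eq: "f (s, t) = (s\<^sup>2 + (t + 1)\<^sup>2) * ((s - 1)\<^sup>2 + t\<^sup>2) * (s\<^sup>2 + (t - 1)\<^sup>2)"
  by (simp add: f_def \<zeta>\<^sub>1_def \<zeta>\<^sub>2_def \<zeta>\<^sub>3_def norm_prod_def)

lemma f_nonneg: "0 \<le> f \<mu>"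
  by (simp add: f_def)

text \<open>For small \<open>t\<close> the zeros \<open>(0, -1)\<close> and \<open>(0, 1)\<close>
  are at distance at least 1/2, so their factors contribute 1/4 each and (s - 1)^2 is left.
  Otherwise \<open>(1, 0)\<close> is at distance at least 1/2, and the zero on the opposite side of
  the axis t = 0 at distance at least 1; the remaining factor is at least s^2.\<close>

lemma f_lower_bound: "(s - s\<^sub>0)\<^sup>2 / 16 \<le> f (s, t)"
  if "s\<^sub>0 = (if \<bar>t\<bar> \<le> 1 / 2 then 1 else 0)"
proof (cases "\<bar>t\<bar> \<le> 1 / 2")
  case True
  then have "(1 / 2)\<^sup>2 \<le> (t + 1)\<^sup>2" "(1 / 2)\<^sup>2 \<le> (t - 1)\<^sup>2"
    by (intro abs_le_square_iff[THEN iffD1]; simp)+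
  then have "1 / 4 \<le> s\<^sup>2 + (t + 1)\<^sup>2" "1 / 4 \<le> s\<^sup>2 + (t - 1)\<^sup>2"
    by (auto simp: power2_eq_square intro: add_increasing)
  then have "1 / 4 * (s - 1)\<^sup>2 * (1 / 4) \<le> f (s, t)"
    unfolding f_eq by (intro mult_mono) auto
  with True that show ?thesis by simp
next
  case False
  have "(1 / 2)\<^sup>2 \<le> t\<^sup>2"
    using False by (intro abs_le_square_iff[THEN iffD1]) simp
  then have 1: "1 / 4 \<le> (s - 1)\<^sup>2 + t\<^sup>2"
    by (auto simp: power2_eq_square intro: add_increasing)
  have "1 \<le> s\<^sup>2 + (t + 1)\<^sup>2 \<or> 1 \<le> s\<^sup>2 + (t - 1)\<^sup>2"
  proof (cases "t \<ge> 0")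
    case True
    then have "1\<^sup>2 \<le> (t + 1)\<^sup>2" by (intro power_mono) auto
    then show ?thesis by (simp add: add_increasing)
  next
    case False
    then have "1\<^sup>2 \<le> (t - 1)\<^sup>2" by (intro abs_le_square_iff[THEN iffD1]) simp
    then show ?thesis by (simp add: add_increasing)
  qed
  then have "1 / 4 * s\<^sup>2 \<le> f (s, t)"
  proof
    assume "1 \<le> s\<^sup>2 + (t + 1)\<^sup>2"
    with 1 have "1 * (1 / 4) * s\<^sup>2 \<le> f (s, t)"
      unfolding f_eq by (intro mult_mono) auto
    then show ?thesis by simp
  next
    assume "1 \<le> s\<^sup>2 + (t - 1)\<^sup>2"
    with 1 have "s\<^sup>2 * (1 / 4) * 1 \<le> f (s, t)"
      unfolding f_eq by (intro mult_mono) auto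
    then show ?thesis by simp
  qed
  moreover have "0 \<le> s\<^sup>2" by simp
  ultimately have "s\<^sup>2 / 16 \<le> f (s, t)" by linarith
  with False that show ?thesis by simp
qed

text \<open>
  For a fixed second component \<open>t\<close>, the cheap values of \<open>s\<close> all lie near one and the same
  number, namely \<open>1\<close> for small \<open>t\<close> and \<open>0\<close> otherwise; so \<open>s' - s = 1\<close> has a cost.
\<close>

lemma f_pair_lower_bound: "(s' - s - 1 / 2) / 16 \<le> f (s, t) + f (s', t)"
proof -
  define s\<^sub>0 where "s\<^sub>0 = (if \<bar>t\<bar> \<le> 1 / 2 then 1 else 0 :: real)"
  \<comment> \<open>These are the tangent inequalities r^2 >= r - 1/4 and r^2 >= -r - 1/4. In their
    sum \<open>s\<^sub>0\<close> cancels and the loss is 1/2, less than the jump 1 of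
    \<open>u_0\<close>.\<close>
  have "0 \<le> (s' - s\<^sub>0 - 1 / 2)\<^sup>2" "0 \<le> (s - s\<^sub>0 + 1 / 2)\<^sup>2"
    by simp_all
  then have "s' - s - 1 / 2 \<le> (s - s\<^sub>0)\<^sup>2 + (s' - s\<^sub>0)\<^sup>2"
    by (simp add: power2_eq_square algebra_simps)
  with f_lower_bound[OF s\<^sub>0_def, of s] f_lower_bound[OF s\<^sub>0_def, of s'] show ?thesis
    by simp
qed

lemma f_growth: "f \<mu> \<le> 64 * (1 + norm \<mu> powr 6)"
proof -
  \<comment> \<open>All three zeros have norm 1, so each distance is at most \<open>2 * r\<close>;
    the constant 64 is 2^6.\<close>
  define r where "r = max 1 (norm \<mu>)"
  have "norm \<zeta>\<^sub>1 = 1" "norm \<zeta>\<^sub>2 = 1" "norm \<zeta>\<^sub>3 = 1"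
    by (simp_all add: \<zeta>\<^sub>1_def \<zeta>\<^sub>2_def \<zeta>\<^sub>3_def norm_prod_def)
  then have le: "norm (\<mu> - \<zeta>\<^sub>1) \<le> 2 * r" "norm (\<mu> - \<zeta>\<^sub>2) \<le> 2 * r" "norm (\<mu> - \<zeta>\<^sub>3) \<le> 2 * r"
    using norm_triangle_ineq4[of \<mu> \<zeta>\<^sub>1] norm_triangle_ineq4[of \<mu> \<zeta>\<^sub>2] norm_triangle_ineq4[of \<mu> \<zeta>\<^sub>3]
    unfolding r_def by linarith+
  have "f \<mu> \<le> (2 * r)\<^sup>2 * (2 * r)\<^sup>2 * (2 * r)\<^sup>2"
    unfolding f_def using le by (intro mult_mono power_mono) (auto simp: r_def)
  also have "\<dots> = 64 * r ^ 6"
    by (simp add: power_mult_distrib flip: power_add)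
  also have "r ^ 6 \<le> 1 + norm \<mu> powr 6"
    by (cases "1 \<le> norm \<mu>") (auto simp: r_def powr_numeral)
  finally show ?thesis by simp
qed

lemma f_measurable: "f \<in> borel_measurable borel"
  unfolding f_def[abs_def] by (intro borel_measurable_continuous_onI continuous_intros)

lemma Lp_integrable_f:
  assumes fin: "finite_measure (lebesgue_on \<Omega>)" and u: "u \<in> Lp 6 \<Omega>"
  shows "integrable (lebesgue_on \<Omega>) (\<lambda>x. f (u x))"
proof -
  interpret finite_measure "lebesgue_on \<Omega>" by fact
  note [measurable] = f_measurable
  show ?thesis
    by (rule Bochner_Integration.integrable_bound[where f = "\<lambda>x. 64 * (1 + norm (u x) powr 6)"])
       (use u f_growth in \<open>auto simp: Lp_def f_nonneg\<close>)
qed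

section \<open>Lower bound for the energy\<close>

lemma fst_measurable: "fst \<in> borel_measurable (borel :: (real \<times> real) measure)"
  by (intro borel_measurable_continuous_onI continuous_intros)

lemma snd_measurable: "snd \<in> borel_measurable (borel :: (real \<times> real) measure)"
  by (intro borel_measurable_continuous_onI continuous_intros)

lemma box_vimage_shift: "(0, h) + x \<in> box (a, c + h) (b, d + h) \<longleftrightarrow> x \<in> box (a, c) (b, d)"
  for x :: "real \<times> real"
  by (cases x) (auto simp: box_real_prod)

lemma set_integral_box_shift:
  fixes g :: "real \<times> real \<Rightarrow> real"
  assumes "set_borel_measurable borel (box (a, c + h) (b, d + h)) g"
  shows "(LBINT x:box (a, c + h) (b, d + h). g x) = (LBINT x:box (a, c) (b, d). g ((0, h) + x))"
  using lborel_integral_translate[of "\<lambda>x. indicator (box (a, c + h) (b, d + h)) x *\<^sub>R g x" "(0, h)"] assms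
  by (simp add: set_lebesgue_integral_def set_borel_measurable_def indicator_def box_vimage_shift)

lemma measure_box_real_prod:
  "a \<le> b \<Longrightarrow> c \<le> d \<Longrightarrow> measure lborel (box (a, c) (b, d)) = (b - a) * (d - c :: real)"
  for a b :: real
  by (simp add: measure_lborel_box_eq Basis_prod_def sum.union_disjoint prod.union_disjoint inner_prod_def)

lemma measure_cbox_real_prod:
  "a \<le> b \<Longrightarrow> c \<le> d \<Longrightarrow> measure lborel (cbox (a, c) (b, d)) = (b - a) * (d - c :: real)"
  for a b :: real
  by (simp add: measure_lborel_cbox_eq Basis_prod_def sum.union_disjoint prod.union_disjoint inner_prod_def)

lemma test_functions_C_k: "\<psi> \<in> test_functions \<Omega> \<Longrightarrow> C_k k \<psi>"
  unfolding test_functions_def by blast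

lemma test_functions_continuous_derivative:
  "\<psi> \<in> test_functions \<Omega> \<Longrightarrow> continuous_on UNIV (\<lambda>x. frechet_derivative \<psi> (at x) v)"
  using C_k_Suc_frechet[OF test_functions_C_k, of \<psi> \<Omega> 0 v] by simp

text \<open>The pair estimate is applied at x and its vertical shift by \<open>h\<close>, for almost
  every x in the lower box. Since the left side depends on \<open>u\<close> only through an integral
  against a bounded weight, it survives weak limits.\<close>

lemma energy_lower_bound:
  fixes \<Omega> :: "(real \<times> real) set"
  assumes \<Omega>: "\<Omega> \<in> sets borel" "bounded \<Omega>" and u: "u \<in> U0 \<Omega>"
    and sub: "{a..b} \<times> {c..d + h} \<subseteq> \<Omega>" and le: "a \<le> b" "c \<le> d" and h: "0 \<le> h" "d \<le> c + h"
  shows "((LINT x|lebesgue_on \<Omega>.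
        (indicator (box (a, c + h) (b, d + h)) x - indicator (box (a, c) (b, d)) x) * fst (u x))
      - (b - a) * (d - c) / 2) / 16 \<le> (LINT x|lebesgue_on \<Omega>. f (u x))"
proof -
  define Q where "Q = box (a, c) (b, d)"
  define Q' where "Q' = box (a, c + h) (b, d + h)"
  have Q_sets: "Q \<in> sets borel" "Q' \<in> sets borel"
    by (simp_all add: Q_def Q'_def)
  have "Q \<inter> Q' = {}"
    using h by (auto simp: Q_def Q'_def box_real_prod)
  have QQ': "Q \<union> Q' \<subseteq> \<Omega>"
    by (rule subset_trans[OF _ sub]) (use h in \<open>auto simp: Q_def Q'_def box_real_prod\<close>)
  have Q_shift: "(0, h) + x \<in> Q' \<longleftrightarrow> x \<in> Q" for x
    unfolding Q_def Q'_def by (rule box_vimage_shift)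
  note fin = finite_measure_lebesgue_on_bounded[OF \<Omega>]
  have uL: "u \<in> Lp 6 \<Omega>" and weak: "weak_d2_zero \<Omega> (\<lambda>x. snd (u x))"
    using u by (auto simp: U0_def)
  then have um: "u \<in> borel_measurable (lebesgue_on \<Omega>)"
    by (simp add: Lp_def)
  obtain U where Um: "U \<in> borel_measurable borel" and U: "AE x in lborel. x \<in> \<Omega> \<longrightarrow> u x = U x"
    using ex_borel_representative[OF um \<Omega>(1)] .
  define A where "A x = fst (U x)" for x
  define B where "B x = snd (U x)" for x
  have Am [measurable]: "A \<in> borel_measurable borel" and Bm [measurable]: "B \<in> borel_measurable borel"
    and fUm [measurable]: "(\<lambda>x. f (U x)) \<in> borel_measurable borel"
    unfolding A_def[abs_def] B_def[abs_def]
    using measurable_compose[OF Um fst_measurable] measurable_compose[OF Um snd_measurable] measurable_compose[OF Um f_measurable]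
    by auto
  have fstum: "(\<lambda>x. fst (u x)) \<in> borel_measurable (lebesgue_on \<Omega>)"
    and sndum: "(\<lambda>x. snd (u x)) \<in> borel_measurable (lebesgue_on \<Omega>)"
    and fum: "(\<lambda>x. f (u x)) \<in> borel_measurable (lebesgue_on \<Omega>)"
    using measurable_compose[OF um fst_measurable] measurable_compose[OF um snd_measurable] measurable_compose[OF um f_measurable]
    by auto
  have norm_int: "integrable (lebesgue_on \<Omega>) (\<lambda>x. norm (u x))"
    by (rule Lp_integrable_norm[OF fin _ uL]) simp
  have "\<bar>fst y\<bar> \<le> norm y" "\<bar>snd y\<bar> \<le> norm y" for y :: "real \<times> real"
    using norm_fst_le[of "fst y" "snd y"] norm_snd_le[of "snd y" "fst y"] by auto
  then have "integrable (lebesgue_on \<Omega>) (\<lambda>x. fst (u x))" "integrable (lebesgue_on \<Omega>) (\<lambda>x. snd (u x))"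
    using Bochner_Integration.integrable_bound[OF norm_int fstum]
      Bochner_Integration.integrable_bound[OF norm_int sndum]
    by auto
  moreover have
    AE: "AE x in lborel. x \<in> \<Omega> \<longrightarrow> fst (u x) = A x" "AE x in lborel. x \<in> \<Omega> \<longrightarrow> snd (u x) = B x"
    "AE x in lborel. x \<in> \<Omega> \<longrightarrow> f (u x) = f (U x)"
    using U by (eventually_elim, simp add: A_def B_def)+
  ultimately have intA: "set_integrable lborel \<Omega> A" and intB: "set_integrable lborel \<Omega> B"
    and intf: "set_integrable lborel \<Omega> (\<lambda>x. f (U x))"
    using lebesgue_on_eq_lborel(2)[OF \<Omega>(1) fstum Am AE(1)]
      lebesgue_on_eq_lborel(2)[OF \<Omega>(1) sndum Bm AE(2)]
      lebesgue_on_eq_lborel(2)[OF \<Omega>(1) fum fUm AE(3)] Lp_integrable_f[OF fin uL]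
    by auto
  have subset_int: "set_integrable lborel Q g" "set_integrable lborel Q' g"
    "set_integrable lborel Q (\<lambda>x. g ((0, h) + x))"
    if "set_integrable lborel \<Omega> g" for g :: "real \<times> real \<Rightarrow> real"
  proof -
    show "set_integrable lborel Q g" and Q': "set_integrable lborel Q' g"
      using QQ' Q_sets by (auto intro: set_integrable_subset[OF that])
    show "set_integrable lborel Q (\<lambda>x. g ((0, h) + x))"
      using lborel_integrable_translate[OF Q'[unfolded set_integrable_def], of "(0, h)"]
      by (simp add: set_integrable_def indicator_def Q_shift)
  qed
  have shift: "(LBINT x:Q'. g x) = (LBINT x:Q. g ((0, h) + x))"
    if "g \<in> borel_measurable borel" for g :: "real \<times> real \<Rightarrow> real"
    unfolding Q_def Q'_def using that
    by (intro set_integral_box_shift) (simp add: set_borel_measurable_def)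
  \<comment> \<open>Extension by zero makes the second component integrable on the plane, as the
    shift lemma requires; both boxes lie in \<open>\<Omega>\<close>, so nothing changes
    there.\<close>
  define W where "W x = indicator \<Omega> x *\<^sub>R B x" for x
  have "AE x in lborel. x \<in> Q \<longrightarrow> W ((0, h) + x) = W x"
    unfolding Q_def
  proof (rule weak_d2_zero_AE_shift[OF _ _ sub h(1)])
    show "integrable lborel W"
      using intB unfolding set_integrable_def W_def[abs_def] .
    fix \<psi> assume \<psi>: "\<psi> \<in> test_functions \<Omega>"
    then have d\<psi> [measurable]: "(\<lambda>x. frechet_derivative \<psi> (at x) (0, 1)) \<in> borel_measurable borel"
      by (intro borel_measurable_continuous_onI test_functions_continuous_derivative)
    have "(LBINT x. W x * frechet_derivative \<psi> (at x) (0, 1))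
        = (LBINT x:\<Omega>. B x * frechet_derivative \<psi> (at x) (0, 1))"
      by (simp add: W_def set_lebesgue_integral_def mult.assoc)
    also have "\<dots> = (LINT x|lebesgue_on \<Omega>. snd (u x) * frechet_derivative \<psi> (at x) (0, 1))"
    proof (rule lebesgue_on_eq_lborel(1)[symmetric, OF \<Omega>(1)])
      show "(\<lambda>x. snd (u x) * frechet_derivative \<psi> (at x) (0, 1)) \<in> borel_measurable (lebesgue_on \<Omega>)"
        using d\<psi>
        by (intro borel_measurable_times[OF sndum measurable_restrict_space1[OF measurable_completion]])
           simp
      show "AE x in lborel. x \<in> \<Omega> \<longrightarrow> snd (u x) * frechet_derivative \<psi> (at x) (0, 1)
          = B x * frechet_derivative \<psi> (at x) (0, 1)"
        using AE(2) by eventually_elim simp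
    qed measurable
    also have "\<dots> = 0"
      using weak \<psi> by (simp add: weak_d2_zero_def)
    finally show "(LBINT x. W x * frechet_derivative \<psi> (at x) (0, 1)) = 0" .
  qed
  then have B_shift: "AE x in lborel. x \<in> Q \<longrightarrow> B ((0, h) + x) = B x"
  proof eventually_elim
    case (elim x)
    show ?case
    proof
      assume "x \<in> Q"
      then have "x \<in> \<Omega>" "(0, h) + x \<in> \<Omega>"
        using QQ' Q_shift[of x] by auto
      with elim \<open>x \<in> Q\<close> show "B ((0, h) + x) = B x"
        by (simp add: W_def)
    qed
  qed
  have "(LINT x|lebesgue_on \<Omega>. (indicator Q' x - indicator Q x) * fst (u x))
      = (LBINT x:\<Omega>. (indicator Q' x - indicator Q x) * A x)"
  proof (rule lebesgue_on_eq_lborel(1)[OF \<Omega>(1)])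
    show "(\<lambda>x. (indicator Q' x - indicator Q x) * fst (u x)) \<in> borel_measurable (lebesgue_on \<Omega>)"
      using Q_sets
      by (intro borel_measurable_times[OF measurable_restrict_space1[OF measurable_completion] fstum])
         simp
    show "AE x in lborel. x \<in> \<Omega> \<longrightarrow> (indicator Q' x - indicator Q x) * fst (u x)
        = (indicator Q' x - indicator Q x) * A x"
      using AE(1) by eventually_elim simp
  qed (use Q_sets in measurable)
  also have "\<dots> = (LBINT x. indicator Q' x *\<^sub>R A x - indicator Q x *\<^sub>R A x)"
    unfolding set_lebesgue_integral_def using QQ'
    by (intro Bochner_Integration.integral_cong) (auto simp: indicator_def)
  also have "\<dots> = (LBINT x:Q'. A x) - (LBINT x:Q. A x)"
    using subset_int[OF intA] unfolding set_integrable_def set_lebesgue_integral_def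
    by (intro Bochner_Integration.integral_diff)
  also have "\<dots> = (LBINT x:Q. A ((0, h) + x) - A x)"
    using subset_int[OF intA] by (simp add: shift set_integral_diff)
  finally have \<Phi>: "(LINT x|lebesgue_on \<Omega>. (indicator Q' x - indicator Q x) * fst (u x))
      = (LBINT x:Q. A ((0, h) + x) - A x)" .
  have Q_const: "set_integrable lborel Q (\<lambda>x. 1 / 2 :: real)"
    "(LBINT x:Q. 1 / 2) = (b - a) * (d - c) / 2"
    using measure_box_real_prod[OF le] emeasure_bounded_finite[of Q]
    by (simp_all add: set_integrable_def set_lebesgue_integral_def Q_def less_top)
  have "((LINT x|lebesgue_on \<Omega>. (indicator Q' x - indicator Q x) * fst (u x))
      - (b - a) * (d - c) / 2) / 16 = (LBINT x:Q. (A ((0, h) + x) - A x - 1 / 2) / 16)"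
    using subset_int[OF intA] Q_const
    by (simp add: \<Phi> set_integral_diff)
  also have "\<dots> \<le> (LBINT x:Q. f (U x) + f (U ((0, h) + x)))"
  proof (rule set_integral_mono_AE)
    show "AE x\<in>Q in lborel. (A ((0, h) + x) - A x - 1 / 2) / 16 \<le> f (U x) + f (U ((0, h) + x))"
      using B_shift
    proof eventually_elim
      case (elim x)
      have "f (U y) = f (A y, B y)" for y
        by (simp add: A_def B_def)
      with elim show ?case
        using f_pair_lower_bound[of "A ((0, h) + x)" "A x" "B x"] by auto
    qed
  qed (use subset_int[OF intA] subset_int[OF intf] Q_const(1) in auto)
  also have "\<dots> = (LBINT x:Q. f (U x)) + (LBINT x:Q'. f (U x))"
    using subset_int[OF intf] by (simp add: set_integral_add shift)
  \<comment> \<open>The boxes are disjoint because \<open>d \<le> c + h\<close>, so no energy is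
    counted twice.\<close>
  also have "\<dots> = (LBINT x:Q \<union> Q'. f (U x))"
    using subset_int[OF intf] \<open>Q \<inter> Q' = {}\<close> by (simp add: set_integral_Un)
  also have "\<dots> \<le> (LBINT x:\<Omega>. f (U x))"
    unfolding set_lebesgue_integral_def
  proof (rule integral_mono)
    show "integrable lborel (\<lambda>x. indicator (Q \<union> Q') x *\<^sub>R f (U x))"
      using set_integrable_subset[OF intf _ QQ'] Q_sets by (simp add: set_integrable_def)
    show "integrable lborel (\<lambda>x. indicator \<Omega> x *\<^sub>R f (U x))"
      using intf by (simp add: set_integrable_def)
    show "indicator (Q \<union> Q') x *\<^sub>R f (U x) \<le> indicator \<Omega> x *\<^sub>R f (U x)" for x
      using QQ' f_nonneg[of "U x"] by (auto simp: indicator_def)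
  qed
  also have "\<dots> = (LINT x|lebesgue_on \<Omega>. f (u x))"
    by (rule lebesgue_on_eq_lborel(1)[symmetric, OF \<Omega>(1) fum fUm AE(3)])
  finally show ?thesis
    unfolding Q_def Q'_def .
qed

section \<open>Weakly null oscillating sequences\<close>

lemma frechet_derivative_eq_0_outside_support:
  assumes "x \<notin> closure {x. \<psi> x \<noteq> 0}"
  shows "frechet_derivative \<psi> (at x) v = (0 :: real)"
proof -
  have "(\<psi> has_derivative (\<lambda>_. 0)) (at x)"
    by (rule has_derivative_transform_within_open[of "\<lambda>_. 0" _ _ _ "- closure {x. \<psi> x \<noteq> 0}"])
       (use assms closure_subset[of "{x. \<psi> x \<noteq> 0}"] in auto)
  from frechet_derivative_at[OF this] show ?thesis by metis
qed

text \<open>Fubini: on each vertical line the integral of the derivative of \<open>\<psi>\<close>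
  along the line is a difference of two boundary values, both zero by compact support, and
  \<open>s\<close> is constant there.\<close>

lemma weak_d2_zero_fst:
  fixes s :: "real \<Rightarrow> real"
  assumes \<Omega>: "\<Omega> \<in> sets borel"
    and s [measurable]: "s \<in> borel_measurable borel" and s1: "\<And>t. \<bar>s t\<bar> \<le> 1"
  shows "weak_d2_zero \<Omega> (\<lambda>x. s (fst x))"
  unfolding weak_d2_zero_def
proof
  fix \<psi> assume \<psi>: "\<psi> \<in> test_functions \<Omega>"
  define K where "K = closure {x. \<psi> x \<noteq> 0}"
  have K: "compact K" "K \<subseteq> \<Omega>"
    using \<psi> by (auto simp: test_functions_def K_def)
  define d\<psi> where "d\<psi> x = frechet_derivative \<psi> (at x) (0, 1)" for x
  have d\<psi>_cont: "continuous_on UNIV d\<psi>"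
    unfolding d\<psi>_def[abs_def] by (rule test_functions_continuous_derivative[OF \<psi>])
  then have d\<psi>_m [measurable]: "d\<psi> \<in> borel_measurable borel"
    by (rule borel_measurable_continuous_onI)
  note [measurable] = fst_measurable
  have d\<psi>0: "d\<psi> x = 0" if "x \<notin> K" for x
    using that unfolding d\<psi>_def K_def by (rule frechet_derivative_eq_0_outside_support)
  have int_d\<psi>: "integrable lborel d\<psi>"
  proof -
    have "integrable lborel (\<lambda>x. indicator K x *\<^sub>R d\<psi> x)"
      by (rule borel_integrable_compact[OF K(1) continuous_on_subset[OF d\<psi>_cont subset_UNIV]])
    also have "(\<lambda>x. indicator K x *\<^sub>R d\<psi> x) = d\<psi>"
      using d\<psi>0 by (auto simp: fun_eq_iff indicator_def)
    finally show ?thesis .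
  qed
  have int: "integrable lborel (\<lambda>x. s (fst x) * d\<psi> x)"
    using mult_mono[OF s1 order_refl]
    by (intro Bochner_Integration.integrable_bound[OF int_d\<psi>]) (auto simp: abs_mult mult_left_le_one_le s1)
  obtain a where a: "K \<subseteq> cbox (-a) a"
    using bounded_subset_cbox_symmetric[OF compact_imp_bounded[OF K(1)]] .
  \<comment> \<open>The added 1 places the endpoints \<open>(t, R)\<close> and
    \<open>(t, - R)\<close> themselves outside \<open>K\<close>, where \<open>\<psi>\<close> is
    zero.\<close>
  define R where "R = \<bar>snd a\<bar> + 1"
  have R: "(t, y) \<notin> K" if "\<bar>y\<bar> \<ge> R" for t y
    using that a by (auto simp: R_def cbox_def Basis_prod_def inner_prod_def)
  have inner: "(LBINT y. d\<psi> (t, y)) = 0" for t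
  proof -
    have der: "((\<lambda>y. \<psi> (t, y)) has_real_derivative d\<psi> (t, y)) (at y)" for y
    proof -
      have \<psi>': "(\<psi> has_derivative frechet_derivative \<psi> (at (t, y))) (at (t, y))"
        by (rule C_k_Suc_has_derivative[OF test_functions_C_k[OF \<psi>]])
      have "((\<lambda>y. (t, y)) has_derivative (\<lambda>v. (0, v))) (at y)"
        by (auto intro!: derivative_eq_intros)
      from has_derivative_compose[OF this \<psi>']
      have "((\<lambda>y. \<psi> (t, y)) has_derivative (\<lambda>v. frechet_derivative \<psi> (at (t, y)) (0, v))) (at y)" .
      moreover have "frechet_derivative \<psi> (at (t, y)) (0, v) = d\<psi> (t, y) * v" for v
        using linear_scale[OF bounded_linear.linear[OF has_derivative_bounded_linear[OF \<psi>']], of v "(0, 1)"]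
        by (simp add: d\<psi>_def)
      ultimately show ?thesis
        by (simp add: has_field_derivative_def)
    qed
    have "d\<psi> (t, y) = 0" if "y \<notin> {- R..R}" for y
      using that by (intro d\<psi>0 R) auto
    then have "(LBINT y. d\<psi> (t, y)) = (LBINT y. d\<psi> (t, y) * indicator {- R..R} y)"
      by (intro Bochner_Integration.integral_cong) (auto simp: indicator_def)
    also have "\<dots> = \<psi> (t, R) - \<psi> (t, - R)"
    proof (rule integral_FTC_Icc_real)
      show "isCont (\<lambda>y. d\<psi> (t, y)) y" for y
        using continuous_on_compose2[OF d\<psi>_cont, of UNIV "Pair t"]
        by (auto simp: continuous_on_eq_continuous_at intro: continuous_intros)
    qed (use der in \<open>auto simp: R_def\<close>)
    also have "\<dots> = 0"
    proof -
      have "\<psi> x = 0" if "x \<notin> K" for x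
        using that closure_subset[of "{x. \<psi> x \<noteq> 0}"] by (auto simp: K_def)
      then show ?thesis using R[of R t] R[of "- R" t] by simp
    qed
    finally show ?thesis .
  qed
  have "(LINT x|lebesgue_on \<Omega>. s (fst x) * d\<psi> x) = (LBINT x:\<Omega>. s (fst x) * d\<psi> x)"
  proof (rule lebesgue_on_eq_lborel(1)[OF \<Omega>])
    show "(\<lambda>x. s (fst x) * d\<psi> x) \<in> borel_measurable (lebesgue_on \<Omega>)"
      by (rule measurable_restrict_space1[OF measurable_completion]) measurable
  qed measurable
  also have "\<dots> = (LBINT x. s (fst x) * d\<psi> x)"
    unfolding set_lebesgue_integral_def using d\<psi>0 K
    by (intro Bochner_Integration.integral_cong) (auto simp: indicator_def)
  also have "\<dots> = (LBINT t. LBINT y. s t * d\<psi> (t, y))"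
    using lborel_pair.integral_fst'[of "\<lambda>x. s (fst x) * d\<psi> x"] int by (simp add: lborel_prod)
  also have "\<dots> = 0"
    by (simp add: inner)
  finally show "(LINT x|lebesgue_on \<Omega>. s (fst x) * frechet_derivative \<psi> (at x) (0, 1)) = 0"
    by (simp add: d\<psi>_def)
qed

section \<open>Weak convergence from almost orthogonality\<close>

lemma Lp_bounded:
  fixes v :: "'a::euclidean_space \<Rightarrow> 'b::euclidean_space"
  assumes fin: "finite_measure (lebesgue_on \<Omega>)" and v: "v \<in> borel_measurable borel"
    and bd: "\<And>x. norm (v x) \<le> K" and p: "0 \<le> p"
  shows "v \<in> Lp p \<Omega>"
proof -
  interpret finite_measure "lebesgue_on \<Omega>" by fact
  have [measurable]: "v \<in> borel_measurable (lebesgue_on \<Omega>)"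
    using v by (intro measurable_restrict_space1[OF measurable_completion]) simp
  have "integrable (lebesgue_on \<Omega>) (\<lambda>x. norm (v x) powr p)"
    using bd p by (intro integrable_const_bound[where B = "K powr p"] AE_I2) (auto intro: powr_mono2)
  then show ?thesis by (simp add: Lp_def)
qed

text \<open>Additivity of a functional is available only inside \<open>Lp\<close>. Membership of the
  partial sums is taken as the hypothesis \<open>sums\<close>; in the application the sums are
  bounded functions.\<close>

lemma Lp_dual_sum:
  assumes \<phi>: "\<phi> \<in> Lp_dual p \<Omega>" and A: "finite A" and u: "\<And>n. u n \<in> Lp p \<Omega>"
    and sums: "\<And>A c. finite A \<Longrightarrow> (\<lambda>x. \<Sum>n\<in>A. c n *\<^sub>R u n x) \<in> Lp p \<Omega>"
  shows "\<phi> (\<lambda>x. \<Sum>n\<in>A. c n *\<^sub>R u n x) = (\<Sum>n\<in>A. c n * \<phi> (u n))"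
proof -
  have add: "\<phi> (\<lambda>x. v x + w x) = \<phi> v + \<phi> w" if "v \<in> Lp p \<Omega>" "w \<in> Lp p \<Omega>" for v w
    using \<phi> that by (simp add: Lp_dual_def)
  have scale: "\<phi> (\<lambda>x. a *\<^sub>R u n x) = a * \<phi> (u n)" for a n
    using \<phi> u by (simp add: Lp_dual_def)
  show ?thesis
    using A
  proof (induction A rule: finite_induct)
    case empty
    then show ?case using scale[of 0 undefined] by simp
  next
    case (insert m A)
    have "(\<lambda>x. c m *\<^sub>R u m x) \<in> Lp p \<Omega>"
      using sums[of "{m}" c] by simp
    with insert show ?case
      by (simp add: add[OF _ sums] scale)
  qed
qed

text \<open>
  If \<open>\<bar>\<phi>(s\<^sub>n)\<bar> \<ge> \<epsilon>\<close> for all \<open>n\<close> in a set \<open>A\<close> of size \<open>N\<close>, then \<open>S = \<Sum>\<^sub>n\<^sub>\<in>\<^sub>A \<plusminus>s\<^sub>n\<close> with suitable signs has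
  \<open>\<phi>(S) \<ge> N \<epsilon>\<close>. But \<open>\<bar>S\<bar> \<le> N\<close> and almost orthogonality give \<open>\<integral> S\<^sup>6 \<le> N\<^sup>4 \<integral> S\<^sup>2 \<le> K N\<^sup>5\<close>, so \<open>N\<close> is
  bounded. This avoids the representation of the dual of \<open>L\<^sup>6\<close>.
\<close>

lemma weakly_converges_Lp_almost_orthogonal:
  fixes s :: "nat \<Rightarrow> 'a::euclidean_space \<Rightarrow> real" and e :: "'b::euclidean_space"
  assumes \<Omega>: "\<Omega> \<in> sets borel" and B: "B \<in> sets borel" "\<Omega> \<subseteq> B" "bounded B"
    and s [measurable]: "\<And>n. s n \<in> borel_measurable borel" and s1: "\<And>n x. \<bar>s n x\<bar> \<le> 1"
    and orth: "\<And>n m. n \<noteq> m \<Longrightarrow> \<bar>LBINT x:B. s n x * s m x\<bar> \<le> (1 / 2) ^ n + (1 / 2) ^ m"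
    and e: "norm e \<le> 1"
  shows "weakly_converges_Lp 6 \<Omega> (\<lambda>n x. s n x *\<^sub>R e) (\<lambda>_. 0)"
proof -
  have fin: "finite_measure (lebesgue_on \<Omega>)"
    by (rule finite_measure_lebesgue_on_bounded[OF \<Omega> bounded_subset[OF B(3,2)]])
  have ss1: "\<bar>s n x * s m x\<bar> \<le> 1" for n m x
    using mult_mono[OF s1[of n x] s1[of m x]] by (simp add: abs_mult)
  have B_int: "set_integrable lborel B g"
    if [measurable]: "g \<in> borel_measurable borel" and "\<And>x. \<bar>g x\<bar> \<le> K" for g :: "'a \<Rightarrow> real" and K
    unfolding set_integrable_def
  proof (rule Bochner_Integration.integrable_bound[where f = "\<lambda>x. K * indicator B x"])
    have "integrable lborel (indicator B :: 'a \<Rightarrow> real)"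
      using B(1) emeasure_bounded_finite[OF B(3)] by (simp add: less_top)
    then show "integrable lborel (\<lambda>x. K * indicator B x)"
      by simp
    show "(\<lambda>x. indicator B x *\<^sub>R g x) \<in> borel_measurable lborel"
      using B(1) by measurable
    show "AE x in lborel. norm (indicator B x *\<^sub>R g x) \<le> norm (K * indicator B x)"
      using that(2) by (auto simp: indicator_def intro: order_trans[OF _ abs_ge_self])
  qed
  define V where "V = measure lborel B"
  define S where "S A c x = (\<Sum>n\<in>A. c n * s n x)" for A and c :: "nat \<Rightarrow> real" and x
  have S_m [measurable]: "S A c \<in> borel_measurable borel" for A c
    unfolding S_def[abs_def] by measurable
  have S_bound: "\<bar>S A c x\<bar> \<le> (\<Sum>n\<in>A. \<bar>c n\<bar>)" for A c x
    unfolding S_def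
    by (rule order_trans[OF sum_abs sum_mono]) (auto simp: abs_mult s1 mult_left_le)
  have S_eq: "(\<lambda>x. \<Sum>n\<in>A. c n *\<^sub>R s n x *\<^sub>R e) = (\<lambda>x. S A c x *\<^sub>R e)" for A c
    by (simp add: S_def scaleR_sum_left)
  have S_Lp: "(\<lambda>x. S A c x *\<^sub>R e) \<in> Lp 6 \<Omega>" for A c
    by (rule Lp_bounded[OF fin, where K = "\<Sum>n\<in>A. \<bar>c n\<bar>"])
       (use S_bound[of A c] e in \<open>auto intro: order_trans[OF mult_left_le]\<close>)
  have s_Lp: "(\<lambda>x. s n x *\<^sub>R e) \<in> Lp 6 \<Omega>" for n
    using S_Lp[of "{n}" "\<lambda>_. 1"] by (simp add: S_def)
  have S_L2: "(LBINT x:B. (S A c x)\<^sup>2) \<le> card A * (V + 4)"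
    if A: "finite A" and c: "\<And>n. \<bar>c n\<bar> \<le> 1" for A c
  proof -
    have int: "set_integrable lborel B (\<lambda>x. s n x * s m x)" for n m
      by (intro B_int[OF _ ss1]) measurable
    have "(LBINT x:B. (S A c x)\<^sup>2)
        = (LBINT x. \<Sum>n\<in>A. \<Sum>m\<in>A. c n * c m * (indicator B x *\<^sub>R (s n x * s m x)))"
      unfolding set_lebesgue_integral_def
      by (simp add: S_def power2_eq_square sum_product sum_distrib_left mult_ac)
    also have "\<dots> = (\<Sum>n\<in>A. \<Sum>m\<in>A. c n * c m * (LBINT x:B. s n x * s m x))"
      using int unfolding set_integrable_def set_lebesgue_integral_def
      by (simp add: Bochner_Integration.integral_sum Bochner_Integration.integrable_sum)
    \<comment> \<open>The diagonal contributes at most \<open>V\<close> per index. The geometric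
      terms, allowed on the diagonal too, sum to at most 2 in each of the two variables, which gives
      the constant \<open>V + 4\<close>.\<close>
    also have "\<dots> \<le> (\<Sum>n\<in>A. \<Sum>m\<in>A. V * of_bool (n = m) + ((1 / 2) ^ n + (1 / 2) ^ m))"
    proof (intro sum_mono)
      fix n m
      have "\<bar>LBINT x:B. s n x * s m x\<bar> \<le> V * of_bool (n = m) + ((1 / 2) ^ n + (1 / 2) ^ m)"
      proof (cases "n = m")
        case True
        have "(LBINT x:B. s n x * s n x) \<le> (LBINT x:B. 1)"
          using int B_int[of "\<lambda>_. 1" 1] ss1[of n _ n]
          by (intro set_integral_mono) auto
        also have "\<dots> = V"
          using B(1) by (simp add: set_lebesgue_integral_def V_def)
        finally have "(LBINT x:B. s n x * s n x) \<le> V" .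
        moreover have "0 \<le> (LBINT x:B. s n x * s n x)"
          unfolding set_lebesgue_integral_def by (intro Bochner_Integration.integral_nonneg) auto
        ultimately show ?thesis
          using True by (simp add: add_increasing2)
      qed (use orth in simp)
      moreover have "\<bar>c n * c m\<bar> \<le> 1"
        using mult_mono[OF c[of n] c[of m]] by (simp add: abs_mult)
      ultimately have "\<bar>c n * c m\<bar> * \<bar>LBINT x:B. s n x * s m x\<bar>
          \<le> 1 * (V * of_bool (n = m) + ((1 / 2) ^ n + (1 / 2) ^ m))"
        by (intro mult_mono) auto
      then show "c n * c m * (LBINT x:B. s n x * s m x)
          \<le> V * of_bool (n = m) + ((1 / 2) ^ n + (1 / 2) ^ m)"
        by (simp add: abs_mult[symmetric])
    qed
    also have "\<dots> = card A * V + 2 * card A * (\<Sum>n\<in>A. (1 / 2) ^ n)"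
    proof -
      have "(\<Sum>m\<in>A. V * of_bool (n = m)) = V" if "n \<in> A" for n
      proof -
        have "(\<Sum>m\<in>A. V * of_bool (n = m)) = (\<Sum>m\<in>A. if n = m then V else 0)"
          by (intro sum.cong) auto
        then show ?thesis using A that by simp
      qed
      then show ?thesis
        by (simp add: sum.distrib sum_distrib_left mult_ac)
    qed
    finally have "(LBINT x:B. (S A c x)\<^sup>2) \<le> card A * V + 2 * card A * (\<Sum>n\<in>A. (1 / 2) ^ n)" .
    moreover have "(\<Sum>n\<in>A. (1 / 2 :: real) ^ n) \<le> 2"
      using sum_le_suminf[of "\<lambda>n. (1 / 2 :: real) ^ n" A] A suminf_geometric[of "1 / 2 :: real"]
      by simp
    then have "2 * real (card A) * (\<Sum>n\<in>A. (1 / 2) ^ n) \<le> 2 * real (card A) * 2"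
      by (intro mult_left_mono) auto
    ultimately show ?thesis
      by (simp add: algebra_simps)
  qed
  have S_L6: "Lp_norm 6 \<Omega> (\<lambda>x. S A c x *\<^sub>R e) ^ 6 \<le> real (card A) ^ 5 * (V + 4)"
    if A: "finite A" and c: "\<And>n. \<bar>c n\<bar> \<le> 1" for A c
  proof -
    have S_card: "\<bar>S A c x\<bar> \<le> card A" for x
      using order_trans[OF S_bound[of A c x] sum_bounded_above[of A "\<lambda>n. \<bar>c n\<bar>" 1]] c by simp
    have le: "norm (S A c x *\<^sub>R e) powr 6 \<le> real (card A) ^ 4 * (S A c x)\<^sup>2" for x
    proof -
      have "norm (S A c x *\<^sub>R e) powr 6 \<le> \<bar>S A c x\<bar> ^ 6"
        using power_mono[OF mult_left_le[OF e, of "\<bar>S A c x\<bar>"], of 6] by simp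
      also have "\<dots> = \<bar>S A c x\<bar> ^ 4 * (S A c x)\<^sup>2"
        by (simp add: power_even_abs)
      also have "\<dots> \<le> real (card A) ^ 4 * (S A c x)\<^sup>2"
        by (intro mult_right_mono power_mono S_card) simp_all
      finally show ?thesis .
    qed
    have int: "set_integrable lborel B (\<lambda>x. real (card A) ^ 4 * (S A c x)\<^sup>2)"
      using power_mono[OF S_card abs_ge_zero, where n = 2]
      by (intro set_integrable_mult_right B_int[of _ "(real (card A))\<^sup>2"]) simp_all
    have "Lp_norm 6 \<Omega> (\<lambda>x. S A c x *\<^sub>R e) ^ 6 = (LINT x|lebesgue_on \<Omega>. norm (S A c x *\<^sub>R e) powr 6)"
      using Lp_norm_powr[of 6 \<Omega> "\<lambda>x. S A c x *\<^sub>R e"] Lp_norm_nonneg[of 6 \<Omega> "\<lambda>x. S A c x *\<^sub>R e"]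
      by simp
    also have "\<dots> = (LBINT x:\<Omega>. norm (S A c x *\<^sub>R e) powr 6)"
    proof (rule lebesgue_on_eq_lborel(1)[OF \<Omega>])
      show "(\<lambda>x. norm (S A c x *\<^sub>R e) powr 6) \<in> borel_measurable (lebesgue_on \<Omega>)"
        by (rule measurable_restrict_space1[OF measurable_completion]) measurable
    qed measurable
    \<comment> \<open>Near orthogonality is known on \<open>B\<close> only, not on the possibly
      irregular \<open>\<Omega>\<close>; the nonnegative bound allows the domain to be
      enlarged.\<close>
    also have "\<dots> \<le> (LBINT x:B. real (card A) ^ 4 * (S A c x)\<^sup>2)"
      unfolding set_lebesgue_integral_def
    proof (rule integral_mono')
      show "integrable lborel (\<lambda>x. indicator B x *\<^sub>R (real (card A) ^ 4 * (S A c x)\<^sup>2))"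
        using int by (simp add: set_integrable_def)
      show "indicator \<Omega> x *\<^sub>R norm (S A c x *\<^sub>R e) powr 6
          \<le> indicator B x *\<^sub>R (real (card A) ^ 4 * (S A c x)\<^sup>2)" for x
        using le[of x] B(2) by (auto simp: indicator_def)
    qed simp
    also have "\<dots> \<le> real (card A) ^ 4 * (card A * (V + 4))"
      using S_L2[OF that] by (simp add: mult_left_mono)
    finally show ?thesis
      by (simp add: power_Suc2 numeral_eq_Suc mult_ac)
  qed
  have "(\<lambda>n. \<phi> (\<lambda>x. s n x *\<^sub>R e)) \<longlonglongrightarrow> \<phi> (\<lambda>_. 0)" if \<phi>: "\<phi> \<in> Lp_dual 6 \<Omega>" for \<phi>
  proof -
    obtain C where C0: "\<And>u. u \<in> Lp 6 \<Omega> \<Longrightarrow> \<bar>\<phi> u\<bar> \<le> C * Lp_norm 6 \<Omega> u"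
      using \<phi> unfolding Lp_dual_def by blast
    have C: "\<bar>\<phi> u\<bar> \<le> \<bar>C\<bar> * Lp_norm 6 \<Omega> u" if "u \<in> Lp 6 \<Omega>" for u
      by (rule order_trans[OF C0[OF that] mult_right_mono[OF abs_ge_self Lp_norm_nonneg]])
    have \<phi>_S: "\<phi> (\<lambda>x. S A c x *\<^sub>R e) = (\<Sum>n\<in>A. c n * \<phi> (\<lambda>x. s n x *\<^sub>R e))" if "finite A" for A c
      unfolding S_eq[symmetric] by (rule Lp_dual_sum[OF \<phi> that s_Lp]) (simp only: S_eq S_Lp)
    have "finite {n. \<epsilon> \<le> \<bar>\<phi> (\<lambda>x. s n x *\<^sub>R e)\<bar>}" (is "finite ?E") if "\<epsilon> > 0" for \<epsilon>
    proof (rule ccontr)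
      assume "infinite ?E"
      \<comment> \<open>This threshold contradicts N * \<epsilon>^6 <= |C|^6 (V + 4), reached below
        after cancelling N^5; positivity of \<open>N\<close> permits the cancellation.\<close>
      obtain N :: nat where N: "real N > \<bar>C\<bar> ^ 6 * (V + 4) / \<epsilon> ^ 6" "N > 0"
      proof -
        obtain N' :: nat where "real N' > \<bar>C\<bar> ^ 6 * (V + 4) / \<epsilon> ^ 6"
          using reals_Archimedean2 by blast
        then show thesis by (intro that[of "Suc N'"]) auto
      qed
      obtain A where A: "finite A" "card A = N" "A \<subseteq> ?E"
        using infinite_arbitrarily_large[OF \<open>infinite ?E\<close>] by blast
      define c where "c n = sgn (\<phi> (\<lambda>x. s n x *\<^sub>R e))" for n
      have c: "\<bar>c n\<bar> \<le> 1" for n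
        by (simp add: c_def sgn_real_def)
      let ?L = "Lp_norm 6 \<Omega> (\<lambda>x. S A c x *\<^sub>R e)"
      have "N * \<epsilon> \<le> (\<Sum>n\<in>A. \<bar>\<phi> (\<lambda>x. s n x *\<^sub>R e)\<bar>)"
        using sum_bounded_below[of A \<epsilon> "\<lambda>n. \<bar>\<phi> (\<lambda>x. s n x *\<^sub>R e)\<bar>"] A by auto
      also have "\<dots> = \<phi> (\<lambda>x. S A c x *\<^sub>R e)"
        using A(1) by (simp add: \<phi>_S c_def abs_sgn mult.commute)
      also have "\<dots> \<le> \<bar>C\<bar> * ?L"
        using C[OF S_Lp, of A c] by linarith
      finally have "(N * \<epsilon>) ^ 6 \<le> (\<bar>C\<bar> * ?L) ^ 6"
        using \<open>\<epsilon> > 0\<close> by (intro power_mono) auto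
      also have "\<dots> \<le> \<bar>C\<bar> ^ 6 * (N ^ 5 * (V + 4))"
        unfolding power_mult_distrib using S_L6[OF A(1) c] A(2) by (intro mult_left_mono) auto
      finally have "real N ^ 5 * (N * \<epsilon> ^ 6) \<le> real N ^ 5 * (\<bar>C\<bar> ^ 6 * (V + 4))"
        by (simp add: power_mult_distrib numeral_eq_Suc mult_ac)
      then have "N * \<epsilon> ^ 6 \<le> \<bar>C\<bar> ^ 6 * (V + 4)"
        using N(2) by simp
      with N(1) \<open>\<epsilon> > 0\<close> show False
        by (simp add: divide_less_eq)
    qed
    \<comment> \<open>On the naturals the cofinite filter is the filter at infinity, so finiteness
      of every exceptional set is convergence to 0.\<close>
    then have "(\<lambda>n. \<phi> (\<lambda>x. s n x *\<^sub>R e)) \<longlonglongrightarrow> 0"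
      unfolding tendsto_iff eventually_cofinite[symmetric] cofinite_eq_sequentially[symmetric]
      by (simp add: eventually_cofinite not_less)
    moreover have "\<phi> (\<lambda>_. 0) = 0"
      using \<phi>_S[of "{}" undefined] by (simp add: S_def)
    ultimately show ?thesis by simp
  qed
  then show ?thesis
    using s_Lp S_Lp[of "{}" undefined] by (simp add: weakly_converges_Lp_def S_def)
qed

text \<open>The Rademacher function of period 2^(1-n) on the whole line. Parity of the floor never
  yields 0, so \<open>(0, rademacher n t)\<close> is a zero of \<open>f\<close> for every
  \<open>t\<close>.\<close>

definition rademacher :: "nat \<Rightarrow> real \<Rightarrow> real" where
  "rademacher n t = (if even \<lfloor>2 ^ n * t\<rfloor> then 1 else - 1)"

lemma abs_rademacher: "\<bar>rademacher n t\<bar> = 1"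
  by (simp add: rademacher_def)

lemma rademacher_measurable [measurable]: "rademacher n \<in> borel_measurable borel"
  unfolding rademacher_def[abs_def] by measurable

lemma rademacher_shift: "rademacher n ((1 / 2) ^ n + t) = - rademacher n t"
proof -
  have "2 ^ n * ((1 / 2) ^ n + t) = 2 ^ n * t + 1"
    by (simp add: algebra_simps flip: power_mult_distrib)
  then show ?thesis by (simp add: rademacher_def)
qed

text \<open>The shift changes the scaled argument by 2^(m - n), an even integer because
  \<open>n < m\<close>, so the parity of the floor is kept.\<close>

lemma rademacher_shift_eq:
  assumes "n < m"
  shows "rademacher m ((1 / 2) ^ n + t) = rademacher m t"
proof -
  obtain k where "m = n + Suc k"
    using assms less_iff_Suc_add by auto
  then have "2 ^ m * ((1 / 2) ^ n + t) = 2 ^ m * t + of_int (2 ^ Suc k)"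
    by (simp add: power_add algebra_simps flip: power_mult_distrib)
  then have "\<lfloor>2 ^ m * ((1 / 2) ^ n + t)\<rfloor> = \<lfloor>2 ^ m * t\<rfloor> + 2 ^ Suc k"
    by (simp only: floor_add_int)
  then show ?thesis by (simp add: rademacher_def)
qed

text \<open>
  The product changes sign under the shift by \<open>2\<^sup>-\<^sup>n\<close> in the first variable, so only the two strips
  in which the box and its shift differ contribute to the integral.
\<close>

lemma rademacher_almost_orthogonal:
  assumes "n < m" and M: "0 \<le> M"
  shows "\<bar>LBINT x:box (- M, 0) (M, 1::real). rademacher n (fst x) * rademacher m (fst x)\<bar> \<le> (1 / 2) ^ n"
proof -
  let ?B = "box (- M, 0) (M, 1::real)"
  define T :: real where "T = (1 / 2) ^ n"
  have T: "0 \<le> T" by (simp add: T_def)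
  note [measurable] = fst_measurable
  define g where "g x = rademacher n (fst x) * rademacher m (fst x)" for x :: "real \<times> real"
  have g_m [measurable]: "g \<in> borel_measurable borel"
    unfolding g_def[abs_def] by measurable
  have g_shift: "g ((T, 0) + x) = - g x" for x
    using rademacher_shift[of n "fst x"] rademacher_shift_eq[OF assms(1), of "fst x"]
    by (simp add: g_def T_def)
  have g1: "\<bar>g x\<bar> = 1" for x
    by (simp add: g_def abs_mult abs_rademacher)
  have B_fin: "integrable lborel (indicator ?B :: _ \<Rightarrow> real)"
    using emeasure_bounded_finite[of ?B] by (simp add: less_top)
  have int: "integrable lborel (\<lambda>x. indicator ?B x * g x)"
    by (rule Bochner_Integration.integrable_bound[OF B_fin]) (auto simp: abs_mult g1)
  have int': "integrable lborel (\<lambda>x. indicator ?B ((T, 0) + x) * g x)"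
    using lborel_integrable_translate[OF int, of "(T, 0)"] by (simp add: g_shift)
  have "(LBINT x. indicator ?B x * g x) = (LBINT x. indicator ?B ((T, 0) + x) * g ((T, 0) + x))"
    by (rule lborel_integral_translate[symmetric]) measurable
  \<comment> \<open>The sign change makes the integral over the shifted box the negative of the
    original one, so their difference is twice the integral to be estimated.\<close>
  then have "2 * (LBINT x. indicator ?B x * g x)
      = (LBINT x. indicator ?B x * g x) - (LBINT x. indicator ?B ((T, 0) + x) * g x)"
    by (simp add: g_shift)
  also have "\<dots> = (LBINT x. indicator ?B x * g x - indicator ?B ((T, 0) + x) * g x)"
    by (rule Bochner_Integration.integral_diff[OF int int', symmetric])
  finally have "\<bar>2 * (LBINT x. indicator ?B x * g x)\<bar>
      \<le> (LBINT x. \<bar>indicator ?B x * g x - indicator ?B ((T, 0) + x) * g x\<bar>)"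
    by (simp only: integral_abs_bound)
  \<comment> \<open>Closed strips of width \<open>T\<close> and height 1 at the left ends and at the
    right ends of the two boxes cover their symmetric difference, even if \<open>T\<close> exceeds
    \<open>2 * M\<close>. Their total area \<open>2 * T\<close> matches the factor 2 on the
    left.\<close>
  also have "\<dots> \<le> (LBINT x. indicator (cbox (- M - T, 0) (- M, 1::real)) x
      + indicator (cbox (M - T, 0) (M, 1)) x)"
  proof (rule integral_mono)
    show "integrable lborel (\<lambda>x. \<bar>indicator ?B x * g x - indicator ?B ((T, 0) + x) * g x\<bar>)"
      using int int' by simp
    show "integrable lborel (\<lambda>x. indicator (cbox (- M - T, 0) (- M, 1)) x
        + indicator (cbox (M - T, 0) (M, 1::real)) x :: real)"
      using emeasure_bounded_finite[of "cbox (- M - T, 0) (- M, 1::real)"]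
        emeasure_bounded_finite[of "cbox (M - T, 0) (M, 1::real)"]
      by (simp add: less_top)
    show "\<bar>indicator ?B x * g x - indicator ?B ((T, 0) + x) * g x\<bar>
        \<le> indicator (cbox (- M - T, 0) (- M, 1)) x + indicator (cbox (M - T, 0) (M, 1)) x" for x
    proof -
      have "\<bar>indicator ?B x * g x - indicator ?B ((T, 0) + x) * g x\<bar>
          = \<bar>indicator ?B x - indicator ?B ((T, 0) + x)\<bar>"
        by (simp add: g1 abs_mult flip: left_diff_distrib)
      then show ?thesis
        using T by (cases x) (auto simp: indicator_def box_real_prod cbox_Pair_eq)
    qed
  qed
  also have "\<dots> = 2 * T"
    using T M measure_cbox_real_prod[of "- M - T" "- M" 0 1] measure_cbox_real_prod[of "M - T" M 0 1]
      emeasure_bounded_finite[of "cbox (- M - T, 0) (- M, 1::real)"]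
      emeasure_bounded_finite[of "cbox (M - T, 0) (M, 1::real)"]
    by (simp add: less_top)
  finally show ?thesis
    by (simp add: set_lebesgue_integral_def g_def T_def)
qed

lemma rademacher_weakly_null:
  fixes \<Omega> :: "(real \<times> real) set"
  assumes \<Omega>: "\<Omega> \<in> sets borel" and sub: "\<Omega> \<subseteq> box (- M, 0) (M, 1)" and M: "0 \<le> M"
  shows "weakly_converges_Lp 6 \<Omega> (\<lambda>n x. (0::real, rademacher n (fst x))) (\<lambda>_. (0, 0))"
proof -
  have "weakly_converges_Lp 6 \<Omega> (\<lambda>n x. rademacher n (fst x) *\<^sub>R (0::real, 1::real)) (\<lambda>_. 0)"
  proof (rule weakly_converges_Lp_almost_orthogonal[OF \<Omega> _ sub])
    note [measurable] = fst_measurable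
    show "(\<lambda>x. rademacher n (fst x)) \<in> borel_measurable (borel :: (real \<times> real) measure)" for n
      by measurable
    show "\<bar>LBINT x:box (- M, 0) (M, 1::real). rademacher n (fst x) * rademacher m (fst x)\<bar>
        \<le> (1 / 2) ^ n + (1 / 2) ^ m" if "n \<noteq> m" for n m
    proof -
      consider "n < m" | "m < n" using \<open>n \<noteq> m\<close> by linarith
      then show ?thesis
      proof cases
        case 1
        show ?thesis
          by (rule order_trans[OF rademacher_almost_orthogonal[OF 1 M]]) simp
      next
        case 2
        show ?thesis
          unfolding mult.commute[of "rademacher n _"]
          by (rule order_trans[OF rademacher_almost_orthogonal[OF 2 M]]) simp
      qed
    qed
  qed (auto simp: abs_rademacher)
  then show ?thesis
    by (simp add: zero_prod_def)
qed

section \<open>The relaxed energy\<close>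

lemma F_tilde_nonneg: "0 \<le> F_tilde \<Omega> u"
  by (auto simp: F_tilde_def f_nonneg intro: Bochner_Integration.integral_nonneg)

lemma F_tilde_0_nonneg: "0 \<le> F_tilde_0 \<Omega> u"
  unfolding F_tilde_0_def by (auto intro!: Inf_greatest Liminf_bounded simp: F_tilde_nonneg)

lemma F_tilde_0_eq_0:
  assumes "weakly_converges_Lp 6 \<Omega> v u" and "\<And>n. v n \<in> U0 \<Omega>" and "\<And>n x. f (v n x) = 0"
  shows "F_tilde_0 \<Omega> u = 0"
proof (rule antisym)
  have "liminf (\<lambda>n. F_tilde \<Omega> (v n)) = 0"
    using assms(2,3) by (simp add: F_tilde_def Liminf_const flip: zero_ereal_def)
  then show "F_tilde_0 \<Omega> u \<le> 0"
    unfolding F_tilde_0_def using assms(1) by (intro Inf_lower) force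
qed (rule F_tilde_0_nonneg)

section \<open>Zeros of the integrand and of its convex envelope\<close>

lemma f_zeros: "f (0, - 1) = 0" "f (1, 0) = 0" "f (0, 1) = 0"
  by (simp_all add: f_eq)

text \<open>Since \<open>f\<close> is nonnegative, the zero function is itself a convex minorant, so
  the supremum is a maximum as soon as no minorant is positive at \<open>\<mu>\<close>.\<close>

lemma convex_envelope_f_eq_0:
  assumes "\<And>h. convex_on UNIV h \<Longrightarrow> (\<And>y. h y \<le> f y) \<Longrightarrow> h \<mu> \<le> 0"
  shows "convex_envelope f \<mu> = 0"
  unfolding convex_envelope_def
proof (rule cSup_eq_maximum)
  show "0 \<in> {h \<mu> |h. convex_on UNIV h \<and> (\<forall>y. h y \<le> f y)}"
    using f_nonneg by (intro CollectI exI[of _ "\<lambda>_. 0"]) (simp add: convex_on_const)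
qed (use assms in auto)

lemma convex_envelope_f_zeros: "convex_envelope f (0, 0) = 0" "convex_envelope f (1, 0) = 0"
proof -
  show "convex_envelope f (0, 0) = 0"
  proof (rule convex_envelope_f_eq_0)
    fix h :: "real \<times> real \<Rightarrow> real" assume h: "convex_on UNIV h" "\<And>y. h y \<le> f y"
    \<comment> \<open>\<open>(0, 0)\<close> is the midpoint of the zeros \<open>(0, -1)\<close> and
      \<open>(0, 1)\<close>.\<close>
    have "h ((1 - 1 / 2) *\<^sub>R (0, - 1) + (1 / 2) *\<^sub>R (0, 1)) \<le> (1 - 1 / 2) * h (0, - 1) + (1 / 2) * h (0, 1)"
      by (rule convex_onD[OF h(1)]) auto
    then show "h (0, 0) \<le> 0"
      using h(2)[of "(0, - 1)"] h(2)[of "(0, 1)"] by (simp add: f_zeros)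
  qed
  show "convex_envelope f (1, 0) = 0"
    by (rule convex_envelope_f_eq_0) (metis f_zeros(2))
qed

lemma U0_of_snd_eq_0:
  assumes "u \<in> Lp 6 \<Omega>" and "\<And>x. snd (u x) = 0"
  shows "u \<in> U0 \<Omega>"
  using assms by (simp add: U0_def weak_d2_zero_def)

lemma weakly_converges_Lp_const: "u \<in> Lp p \<Omega> \<Longrightarrow> weakly_converges_Lp p \<Omega> (\<lambda>_. u) u"
  by (simp add: weakly_converges_Lp_def)

lemma u_0_measurable: "u_0 \<in> borel_measurable borel"
proof -
  note [measurable] = snd_measurable
  have "u_0 = (\<lambda>x. if snd x \<le> 1 / 2 then (0, 0) else (1, 0))"
    by (auto simp: u_0_def fun_eq_iff)
  also have "\<dots> \<in> borel_measurable borel"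
    by measurable
  finally show ?thesis .
qed

text \<open>Shift 1/2 takes the heights (1/8, 3/8), where the first component of \<open>u_0\<close>
  is 0, to (5/8, 7/8), where it is 1. The functional has value (b - a)/4 at \<open>u_0\<close> and
  the loss is (b - a)/8, so (b - a)/128 remains after division by 16.\<close>

lemma F_tilde_0_u_0_pos:
  assumes \<Omega>: "\<Omega> \<in> sets borel" "bounded \<Omega>" and sub: "{a..b} \<times> {1/8..7/8} \<subseteq> \<Omega>" and ab: "a < b"
  shows "0 < F_tilde_0 \<Omega> u_0"
proof -
  note fin = finite_measure_lebesgue_on_bounded[OF \<Omega>]
  define Q where "Q = box (a, 1/8) (b, 3/8::real)"
  define Q' where "Q' = box (a, 1/8 + 1/2) (b, 3/8 + 1/2 :: real)"
  have Q_sets: "Q \<in> sets borel" "Q' \<in> sets borel"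
    by (simp_all add: Q_def Q'_def)
  have Q'_sub: "Q' \<subseteq> \<Omega>"
    by (rule subset_trans[OF _ sub]) (auto simp: Q'_def box_real_prod)
  define \<Phi> :: "(real \<times> real \<Rightarrow> real \<times> real) \<Rightarrow> real" where
    "\<Phi> u = (LINT x|lebesgue_on \<Omega>. (indicator Q' x - indicator Q x) * fst (u x))" for u
  have g_m: "(\<lambda>x. indicator Q' x - indicator Q x :: real) \<in> borel_measurable (lebesgue_on \<Omega>)"
    using Q_sets by (intro measurable_restrict_space1[OF measurable_completion]) simp
  have \<Phi>_dual: "\<Phi> \<in> Lp_dual 6 \<Omega>"
    unfolding \<Phi>_def[abs_def]
  proof (rule Lp_dual_weighted_integral[OF fin _ g_m])
    show "linear (fst :: real \<times> real \<Rightarrow> real)" by (rule linear_fst)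
    show "\<bar>fst y\<bar> \<le> norm y" for y :: "real \<times> real"
      using norm_fst_le[of "fst y" "snd y"] by simp
  qed (auto simp: indicator_def)
  have "\<Phi> u_0 = (LINT x|lebesgue_on \<Omega>. indicator Q' x)"
    unfolding \<Phi>_def
    by (rule Bochner_Integration.integral_cong) (auto simp: u_0_def Q_def Q'_def box_real_prod indicator_def)
  also have "\<dots> = (LBINT x:\<Omega>. indicator Q' x)"
    using Q_sets by (intro lebesgue_on_eq_lborel(1)[OF \<Omega>(1)] measurable_restrict_space1[OF measurable_completion]) auto
  also have "\<dots> = (LBINT x. indicator Q' x)"
    unfolding set_lebesgue_integral_def using Q'_sub
    by (intro Bochner_Integration.integral_cong) (auto simp: indicator_def)
  also have "\<dots> = (b - a) / 4"
    using ab by (simp add: Q'_def measure_box_real_prod)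
  finally have \<Phi>_u_0: "\<Phi> u_0 = (b - a) / 4" .
  \<comment> \<open>Outside \<open>U0\<close> the energy is infinite, so the bound holds for every
    \<open>u\<close> and no member of the sequence needs separate treatment.\<close>
  have lower: "ereal ((\<Phi> u - (b - a) / 8) / 16) \<le> F_tilde \<Omega> u" for u
    using energy_lower_bound[OF \<Omega>, of u a b "1/8" "3/8" "1/2"] sub ab
    by (auto simp: F_tilde_def \<Phi>_def Q_def Q'_def)
  have "ereal ((b - a) / 128) \<le> F_tilde_0 \<Omega> u_0"
    unfolding F_tilde_0_def
  proof (rule Inf_greatest, clarify)
    fix v assume "weakly_converges_Lp 6 \<Omega> v u_0"
    then have "(\<lambda>n. \<Phi> (v n)) \<longlonglongrightarrow> (b - a) / 4"
      unfolding weakly_converges_Lp_def \<Phi>_u_0[symmetric] using \<Phi>_dual by blast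
    then have "(\<lambda>n. (\<Phi> (v n) - (b - a) / 8) / 16) \<longlonglongrightarrow> ((b - a) / 4 - (b - a) / 8) / 16"
      by (intro tendsto_intros) simp_all
    then have "liminf (\<lambda>n. ereal ((\<Phi> (v n) - (b - a) / 8) / 16)) = ereal (((b - a) / 4 - (b - a) / 8) / 16)"
      by (intro lim_imp_Liminf) auto
    moreover have "liminf (\<lambda>n. ereal ((\<Phi> (v n) - (b - a) / 8) / 16)) \<le> liminf (\<lambda>n. F_tilde \<Omega> (v n))"
      by (intro Liminf_mono always_eventually allI lower)
    moreover have "((b - a) / 4 - (b - a) / 8) / 16 = (b - a) / 128"
      by (simp add: field_simps)
    ultimately show "ereal ((b - a) / 128) \<le> liminf (\<lambda>n. F_tilde \<Omega> (v n))"
      by simp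
  qed
  moreover have "0 < ereal ((b - a) / 128)"
    using ab by simp
  ultimately show ?thesis
    by (rule less_le_trans[rotated])
qed

theorem proposition13:
  fixes \<omega> :: "real set" and \<Omega> :: "(real \<times> real) set"
  assumes "\<omega> \<noteq> {}" and "open \<omega>" and "bounded \<omega>"
    and "\<Omega> = \<omega> \<times> {0<..<1}"
  shows "u_0 \<in> U0 \<Omega> \<and>
    F_tilde_0 \<Omega> u_0 > 0 \<and>
    0 = ereal (measure lebesgue (\<omega> \<times> {0<..<1/2::real}) / measure lebesgue \<Omega>)
          * F_tilde_0 \<Omega> (\<lambda>_. (0, 0))
      + ereal (measure lebesgue (\<omega> \<times> {1/2<..<1::real}) / measure lebesgue \<Omega>)
          * F_tilde_0 \<Omega> (\<lambda>_. (1, 0)) \<and>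
    \<not> (\<exists>V :: real \<times> real \<Rightarrow> real. \<forall>u\<in>U0 \<Omega>.
          integrable (lebesgue_on \<Omega>) (\<lambda>x. V (u x)) \<and>
          F_tilde_0 \<Omega> u = ereal (LINT x|lebesgue_on \<Omega>. V (u x))) \<and>
    F_tilde_0 \<Omega> u_0 > F_conv \<Omega> u_0"
proof -
  have "open \<Omega>" "\<Omega> \<noteq> {}" and bdd: "bounded \<Omega>"
    using assms by (auto intro!: open_Times bounded_Times)
  then have \<Omega>: "\<Omega> \<in> sets borel" by simp
  note fin = finite_measure_lebesgue_on_bounded[OF \<Omega> bdd]
  have const_U0: "(\<lambda>_. (c, 0)) \<in> U0 \<Omega>" for c
    by (rule U0_of_snd_eq_0[OF Lp_bounded[OF fin, where K = "norm (c, 0::real)"]]) auto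
  have u_0_U0: "u_0 \<in> U0 \<Omega>"
    by (rule U0_of_snd_eq_0[OF Lp_bounded[OF fin u_0_measurable, where K = 1]])
       (auto simp: u_0_def norm_prod_def)
  have pos: "0 < F_tilde_0 \<Omega> u_0"
  proof -
    obtain t where "t \<in> \<omega>" using assms(1) by blast
    then obtain e where "e > 0" "cball t e \<subseteq> \<omega>"
      using assms(2) open_contains_cball by blast
    then show ?thesis
      using assms(4) by (intro F_tilde_0_u_0_pos[OF \<Omega> bdd, of "t - e" "t + e"]) (auto simp: cball_eq_atLeastAtMost)
  qed
  have F1: "F_tilde_0 \<Omega> (\<lambda>_. (1, 0)) = 0"
    by (rule F_tilde_0_eq_0[where v = "\<lambda>_ _. (1, 0)"])
       (use const_U0[of 1] in \<open>auto simp: f_zeros U0_def intro: weakly_converges_Lp_const\<close>)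
  have F0: "F_tilde_0 \<Omega> (\<lambda>_. (0, 0)) = 0"
  proof -
    obtain M where M: "\<And>t. t \<in> \<omega> \<Longrightarrow> \<bar>t\<bar> < M" "0 \<le> M"
      using assms(3) unfolding bounded_pos_less by (auto intro: less_imp_le)
    then have "\<Omega> \<subseteq> box (- M, 0) (M, 1)"
      using assms(4) by (force simp: box_real_prod)
    note weak = rademacher_weakly_null[OF \<Omega> this M(2)]
    show ?thesis
    proof (rule F_tilde_0_eq_0[OF weak])
      show "(\<lambda>x. (0, rademacher n (fst x))) \<in> U0 \<Omega>" for n
        using weak weak_d2_zero_fst[OF \<Omega> rademacher_measurable, of n]
        by (simp add: U0_def weakly_converges_Lp_def abs_rademacher)
    qed (simp add: rademacher_def f_zeros)
  qed
  have no_V: False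
    if V: "\<forall>u\<in>U0 \<Omega>. integrable (lebesgue_on \<Omega>) (\<lambda>x. V (u x)) \<and>
      F_tilde_0 \<Omega> u = ereal (LINT x|lebesgue_on \<Omega>. V (u x))" for V :: "real \<times> real \<Rightarrow> real"
  proof -
    \<comment> \<open>For the constant \<open>(c, 0)\<close> the integral is \<open>V (c, 0)\<close>
      times the measure of \<open>\<Omega>\<close>; a nonempty open set has positive measure, so
      zero relaxed energy forces \<open>V (c, 0) = 0\<close>.\<close>
    have "measure (lebesgue_on \<Omega>) (space (lebesgue_on \<Omega>)) \<noteq> 0"
      using open_not_negligible[OF \<open>open \<Omega>\<close> \<open>\<Omega> \<noteq> {}\<close>] bdd \<Omega>
      by (simp add: measure_restrict_space negligible_iff_measure lmeasurable_open[OF bdd \<open>open \<Omega>\<close>])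
    then have "V (c, 0) = 0" if "F_tilde_0 \<Omega> (\<lambda>_. (c, 0)) = 0" for c
      using V const_U0[of c] that by (auto simp: zero_ereal_def)
    then have "V (0, 0) = 0" "V (1, 0) = 0"
      using F0 F1 by auto
    then have "V (u_0 x) = 0" for x
      by (auto simp: u_0_def split: prod.split)
    then have "F_tilde_0 \<Omega> u_0 = 0"
      using V u_0_U0 by (simp add: zero_ereal_def)
    with pos show False by simp
  qed
  have "F_conv \<Omega> u_0 = 0"
  proof -
    have "convex_envelope f (u_0 x) = 0" for x
      by (auto simp: u_0_def convex_envelope_f_zeros split: prod.split)
    then show ?thesis by (simp add: F_conv_def zero_ereal_def)
  qed
  with u_0_U0 pos F0 F1 no_V show ?thesis
    by auto
qed

end
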